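(* There exist $\theta\in(0,\pi/4]$ and real $\alpha,\beta,\gamma>0$ with $\alpha^2+\beta^2+\gamma^2=1$ such that, for the link $|\psi(\theta)\rangle_{AB}=\cos\theta|00\rangle+\sin\theta|11\rangle$ assisted by the W-class resource $|W\rangle_{A'B'K}=\alpha|001\rangle+\beta|010\rangle+\gamma|100\rangle$, deterministic restoration of a Bell pair on $AB$ is possible in the transfer model but impossible in the Bank-measures model.
   Context: All registers $A,B,A',B',K$ are qubits; in $|W\rangle_{A'B'K}$ the tensor factors are ordered $A',B',K$. The global initial state is $|\psi(\theta)\rangle_{AB}\otimes|W\rangle_{A'B'K}$. Alice holds $A,A'$; Bob holds $B,B'$; the Bank holds $K$. LOCC means local quantum operations by Alice and Bob (local ancillas and discarding of systems allowed) with finitely many rounds of classical communication between them. Bank-measures model: the Bank performs a quantum measurement on $K$ (of its choice) and broadcasts the classical outcome; afterwards Alice (on $AA'$) and Bob (on $BB'$) act by LOCC, which may depend on the outcome; the Bank does nothing else. Transfer model: the Bank hands $K$ to Alice and is then absent; Alice (holding $AA'K$) and Bob (holding $BB'$) act by LOCC. Deterministic restoration of a Bell pair on $AB$ means that, with probability one, the final state of the registers $A$ and $B$ is exactly $|\Phi^+\rangle=\frac{1}{\sqrt2}(|00\rangle+|11\rangle)$; other registers may be left in any state or discarded. *)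

theory Defs
  imports Complex_Main "Jordan_Normal_Form.Schur_Decomposition"
begin

text \<open>
  States are density matrices, not necessarily normalised: the trace of the operator attached to a
  branch of a measurement is the probability of that branch.  Tensor factors are ordered with the
  leftmost factor most significant, so the basis vector \<open>|x\<rangle> \<otimes> |y\<rangle>\<close> of a space of dimension
  \<open>m * n\<close> has index \<open>x * n + y\<close>.
\<close>

definition tensor_vec :: "complex vec \<Rightarrow> complex vec \<Rightarrow> complex vec" where
  "tensor_vec u v = vec (dim_vec u * dim_vec v)
     (\<lambda>i. u $ (i div dim_vec v) * v $ (i mod dim_vec v))"

definition tensor_mat :: "complex mat \<Rightarrow> complex mat \<Rightarrow> complex mat" where
  "tensor_mat A B = mat (dim_row A * dim_row B) (dim_col A * dim_col B)
     (\<lambda>(i, j). A $$ (i div dim_row B, j div dim_col B) * B $$ (i mod dim_row B, j mod dim_col B))"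

definition pure_state :: "complex vec \<Rightarrow> complex mat" where
  "pure_state v = mat (dim_vec v) (dim_vec v) (\<lambda>(i, j). v $ i * cnj (v $ j))"

definition mat_trace :: "complex mat \<Rightarrow> complex" where
  "mat_trace A = (\<Sum>i<dim_row A. A $$ (i, i))"

definition sum_mats :: "nat \<Rightarrow> nat \<Rightarrow> complex mat list \<Rightarrow> complex mat" where
  "sum_mats nr nc Ms = mat nr nc (\<lambda>(i, j). \<Sum>M\<leftarrow>Ms. M $$ (i, j))"

definition pos_semidef :: "nat \<Rightarrow> complex mat \<Rightarrow> bool" where
  "pos_semidef n E \<longleftrightarrow> E \<in> carrier_mat n n \<and> (\<forall>v \<in> carrier_vec n. 0 \<le> (E *\<^sub>v v) \<bullet>c v)"

definition povm :: "nat \<Rightarrow> complex mat list \<Rightarrow> bool" where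
  "povm n Es \<longleftrightarrow> (\<forall>E \<in> set Es. pos_semidef n E) \<and> sum_mats n n Es = 1\<^sub>m n"

text \<open>
  A protocol is a finite tree.  At an inner node one party applies a quantum instrument to the
  whole of their local system and broadcasts the outcome.  The outcome selects a branch
  \<open>(d, Ks, P)\<close>, where \<open>Ks\<close> are the Kraus operators of that outcome, \<open>d\<close> is the dimension of the
  party's local system afterwards, and \<open>P\<close> is the remaining protocol.  Since \<open>d\<close> may differ from
  the dimension before, adjoining ancillas and discarding subsystems are instruments with a single
  outcome.
\<close>

datatype protocol =
    Stop
  | Alice "(nat \<times> complex mat list \<times> protocol) list"
  | Bob "(nat \<times> complex mat list \<times> protocol) list"

definition instrument :: "nat \<Rightarrow> (nat \<times> complex mat list) list \<Rightarrow> bool" where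
  "instrument n ops \<longleftrightarrow>
     (\<forall>(d, Ks) \<in> set ops. \<forall>K \<in> set Ks. K \<in> carrier_mat d n) \<and>
     sum_mats n n (map (\<lambda>K. mat_adjoint K * K) (concat (map snd ops))) = 1\<^sub>m n"

fun locc :: "nat \<Rightarrow> nat \<Rightarrow> protocol \<Rightarrow> bool" where
  "locc dA dB Stop \<longleftrightarrow> True"
| "locc dA dB (Alice bs) \<longleftrightarrow>
     instrument dA (map (\<lambda>(d, Ks, P). (d, Ks)) bs) \<and> (\<forall>(d, Ks, P) \<in> set bs. locc d dB P)"
| "locc dA dB (Bob bs) \<longleftrightarrow>
     instrument dB (map (\<lambda>(d, Ks, P). (d, Ks)) bs) \<and> (\<forall>(d, Ks, P) \<in> set bs. locc dA d P)"

definition apply_kraus :: "nat \<Rightarrow> complex mat list \<Rightarrow> complex mat \<Rightarrow> complex mat" where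
  "apply_kraus n Ks \<rho> = sum_mats n n (map (\<lambda>K. K * \<rho> * mat_adjoint K) Ks)"

text \<open>
  The branches of a run on a state \<open>\<rho>\<close> of \<open>\<complex>\<^sup>d\<^sup>A \<otimes> \<complex>\<^sup>d\<^sup>B\<close>: final local dimensions of Alice and Bob
  and final unnormalised state.
\<close>

fun branches :: "nat \<Rightarrow> nat \<Rightarrow> protocol \<Rightarrow> complex mat \<Rightarrow> (nat \<times> nat \<times> complex mat) list" where
  "branches dA dB Stop \<rho> = [(dA, dB, \<rho>)]"
| "branches dA dB (Alice bs) \<rho> =
     concat (map (\<lambda>(d, Ks, P).
       branches d dB P (apply_kraus (d * dB) (map (\<lambda>K. tensor_mat K (1\<^sub>m dB)) Ks) \<rho>)) bs)"
| "branches dA dB (Bob bs) \<rho> =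
     concat (map (\<lambda>(d, Ks, P).
       branches dA d P (apply_kraus (dA * d) (map (\<lambda>K. tensor_mat (1\<^sub>m dA) K) Ks) \<rho>)) bs)"

definition bell :: "complex vec" where
  "bell = vec_of_list [1 / complex_of_real (sqrt 2), 0, 0, 1 / complex_of_real (sqrt 2)]"

text \<open>
  Alice's system is \<open>A \<otimes> R\<close> with \<open>dim R = rA\<close>, Bob's is \<open>B \<otimes> S\<close> with \<open>dim S = rB\<close>; the result is
  the reduced state on \<open>A \<otimes> B\<close>.
\<close>

definition reduced_AB :: "nat \<Rightarrow> nat \<Rightarrow> complex mat \<Rightarrow> complex mat" where
  "reduced_AB rA rB \<sigma> =
     (let idx = (\<lambda>i x y. ((i div 2) * rA + x) * (2 * rB) + ((i mod 2) * rB + y))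
      in mat 4 4 (\<lambda>(i, j). \<Sum>x<rA. \<Sum>y<rB. \<sigma> $$ (idx i x y, idx j x y)))"

text \<open>
  By convention \<open>A\<close> and \<open>B\<close> are the first tensor factors of the final systems of Alice and Bob;
  the remaining factors are arbitrary.  Branches of trace zero have probability zero.
\<close>

definition restores :: "nat \<Rightarrow> nat \<Rightarrow> protocol \<Rightarrow> complex mat \<Rightarrow> bool" where
  "restores dA dB P \<rho> \<longleftrightarrow>
     (\<forall>(dA', dB', \<sigma>) \<in> set (branches dA dB P \<rho>). mat_trace \<sigma> \<noteq> 0 \<longrightarrow>
        (\<exists>rA rB. dA' = 2 * rA \<and> dB' = 2 * rB \<and>
           (1 / mat_trace \<sigma>) \<cdot>\<^sub>m reduced_AB rA rB \<sigma> = pure_state bell))"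

definition link :: "real \<Rightarrow> complex vec" where
  "link \<theta> = vec_of_list [complex_of_real (cos \<theta>), 0, 0, complex_of_real (sin \<theta>)]"

definition W_state :: "real \<Rightarrow> real \<Rightarrow> real \<Rightarrow> complex vec" where
  "W_state \<alpha> \<beta> \<gamma> = vec_of_list
     [0, complex_of_real \<alpha>, complex_of_real \<beta>, 0, complex_of_real \<gamma>, 0, 0, 0]"

text \<open>
  A global vector has its five qubits in the order \<open>A, B, A', B', K\<close>.  The next two functions
  regroup it to the orders \<open>A, A', B, B', K\<close> and \<open>A, A', K, B, B'\<close> respectively.
\<close>

definition amp :: "complex vec \<Rightarrow> nat \<Rightarrow> nat \<Rightarrow> nat \<Rightarrow> nat \<Rightarrow> nat \<Rightarrow> complex" where
  "amp \<Psi> a b a' b' k = \<Psi> $ (16 * a + 8 * b + 4 * a' + 2 * b' + k)"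

definition bank_order :: "complex vec \<Rightarrow> complex vec" where
  "bank_order \<Psi> = vec 32 (\<lambda>i.
     let a = i div 16; a' = i div 8 mod 2; b = i div 4 mod 2; b' = i div 2 mod 2; k = i mod 2
     in amp \<Psi> a b a' b' k)"

definition transfer_order :: "complex vec \<Rightarrow> complex vec" where
  "transfer_order \<Psi> = vec 32 (\<lambda>i.
     let a = i div 16; a' = i div 8 mod 2; k = i div 4 mod 2; b = i div 2 mod 2; b' = i mod 2
     in amp \<Psi> a b a' b' k)"

text \<open>
  The unnormalised state of \<open>A, A', B, B'\<close> after outcome \<open>E\<close> of a measurement on \<open>K\<close>, namely the
  partial trace over \<open>K\<close> of \<open>(1 \<otimes> E) \<rho>\<close>.
\<close>

definition post_bank :: "complex mat \<Rightarrow> complex mat \<Rightarrow> complex mat" where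
  "post_bank E \<rho> =
     (let M = tensor_mat (1\<^sub>m 16) E * \<rho>
      in mat 16 16 (\<lambda>(i, j). \<Sum>k<2. M $$ (2 * i + k, 2 * j + k)))"

definition restorable_bank_measures :: "complex vec \<Rightarrow> bool" where
  "restorable_bank_measures \<Psi> \<longleftrightarrow>
     (\<exists>Es. povm 2 Es \<and>
       (\<forall>E \<in> set Es. \<exists>P. locc 4 4 P \<and>
          restores 4 4 P (post_bank E (pure_state (bank_order \<Psi>)))))"

definition restorable_transfer :: "complex vec \<Rightarrow> bool" where
  "restorable_transfer \<Psi> \<longleftrightarrow>
     (\<exists>P. locc 8 4 P \<and> restores 8 4 P (pure_state (transfer_order \<Psi>)))"

end

(* Seen across the cut between Alice and the rest, a pure state is the matrix M of its amplitudes.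
   If M = X * Y, a Kraus operator K of Alice turns X into K * X and one of Bob acts on Y, and
   completeness of an instrument keeps the total of |X|^2 * |Y|^2 (Frobenius norms) over all
   branches constant.  By Cauchy-Schwarz twice the weight on the Bell state is at most this total,
   so a total below 2 excludes restoration.  An outcome of the Bank acts only on the side of Y.
   The diagonal X with squared entries nearly proportional to the Schmidt coefficients of the cut
   AA' : BB'K, which is less entangled than a Bell pair for alpha = 7/10, beta^2 = 1/2,
   gamma = 1/10 and sin theta = 7/25, therefore gives a total below 2 for every measurement of K.
   Since beta^2 = 1/2, the W-class state is maximally entangled between A'K and B', so in the
   transfer model its Bell pair simply replaces the link. *)
theory Submission
  imports Defs "HOL-Analysis.L2_Norm"
begin

section \<open>Finite sums, row-major indices, Cauchy-Schwarz and matrix entries\<close>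

lemma sum_list_swap:
  fixes f :: "'a \<Rightarrow> 'b \<Rightarrow> 'c :: comm_monoid_add"
  shows "(\<Sum>x\<leftarrow>xs. \<Sum>y\<leftarrow>ys. f x y) = (\<Sum>y\<leftarrow>ys. \<Sum>x\<leftarrow>xs. f x y)"
  by (induction xs) (simp_all add: sum_list_addf)

lemma sum_list_sum_swap:
  fixes f :: "'a \<Rightarrow> 'b \<Rightarrow> 'c :: comm_monoid_add"
  shows "(\<Sum>x\<leftarrow>xs. \<Sum>y\<in>S. f x y) = (\<Sum>y\<in>S. \<Sum>x\<leftarrow>xs. f x y)"
  by (induction xs) (simp_all add: sum.distrib)

lemma sum_list_product:
  fixes f :: "'a \<times> 'b \<Rightarrow> 'c :: comm_monoid_add"
  shows "(\<Sum>p\<leftarrow>List.product xs ys. f p) = (\<Sum>x\<leftarrow>xs. \<Sum>y\<leftarrow>ys. f (x, y))"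
  by (induction xs) (simp_all add: comp_def)

lemma sum_list_concat_map:
  fixes f :: "'b \<Rightarrow> 'c :: comm_monoid_add"
  shows "(\<Sum>y\<leftarrow>concat (map g xs). f y) = (\<Sum>x\<leftarrow>xs. \<Sum>y\<leftarrow>g x. f y)"
  by (induction xs) simp_all

lemma of_real_sum_list:
  "of_real (\<Sum>x\<leftarrow>xs. f x) = (\<Sum>x\<leftarrow>xs. of_real (f x) :: 'a :: real_algebra_1)"
  by (induction xs) simp_all

text \<open>Splits an index of a tensor product into the positions in its two factors, with the left
  factor most significant as in \<open>tensor_vec\<close>.\<close>

lemma sum_lessThan_mult:
  fixes f :: "nat \<Rightarrow> 'a :: comm_monoid_add"
  shows "(\<Sum>i<m * n. f i) = (\<Sum>a<m. \<Sum>b<n. f (a * n + b))"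
proof (induction m)
  case (Suc m)
  have "(\<Sum>i<n + k. f i) = (\<Sum>i<k. f i) + (\<Sum>b<n. f (k + b))" for k
    by (induction n) (simp_all add: add.assoc add.left_commute add.commute)
  from this[of "m * n"] show ?case
    using Suc by simp
qed simp

lemma nat_index_less:
  fixes a b m n :: nat
  assumes "a < m" "b < n"
  shows "a * n + b < m * n"
proof -
  have "a * n + b < a * n + n"
    using assms(2) by simp
  also have "\<dots> \<le> m * n"
    using assms(1) by (metis Suc_leI add.commute mult_Suc mult_le_mono1)
  finally show ?thesis .
qed

lemma cmod_sum_mult_squared_le:
  "(cmod (\<Sum>i\<in>S. x i * y i))\<^sup>2 \<le> (\<Sum>i\<in>S. (cmod (x i))\<^sup>2) * (\<Sum>i\<in>S. (cmod (y i))\<^sup>2)"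
proof -
  have "cmod (\<Sum>i\<in>S. x i * y i) \<le> (\<Sum>i\<in>S. cmod (x i) * cmod (y i))"
    by (rule order_trans[OF norm_sum]) (simp add: norm_mult)
  also have "\<dots> \<le> L2_set (\<lambda>i. cmod (x i)) S * L2_set (\<lambda>i. cmod (y i)) S"
    using L2_set_mult_ineq[of "\<lambda>i. cmod (x i)" "\<lambda>i. cmod (y i)" S] by simp
  finally have "(cmod (\<Sum>i\<in>S. x i * y i))\<^sup>2
      \<le> (L2_set (\<lambda>i. cmod (x i)) S * L2_set (\<lambda>i. cmod (y i)) S)\<^sup>2"
    by (simp add: power_mono)
  then show ?thesis
    by (simp add: L2_set_def power_mult_distrib sum_nonneg)
qed

lemma mat_adjoint_carrier: "A \<in> carrier_mat m n \<Longrightarrow> mat_adjoint A \<in> carrier_mat n m"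
  by (auto simp: mat_adjoint_def)

lemma mat_adjoint_index:
  assumes "A \<in> carrier_mat m n" "i < n" "j < m"
  shows "mat_adjoint A $$ (i, j) = cnj (A $$ (j, i))"
  using assms by (simp add: mat_adjoint_def mat_of_rows_index)

lemma mult_index_sum:
  assumes "A \<in> carrier_mat m n" "B \<in> carrier_mat n l" "i < m" "j < l"
  shows "(A * B) $$ (i, j) = (\<Sum>k<n. A $$ (i, k) * B $$ (k, j))"
  using assms by (simp add: scalar_prod_def atLeast0LessThan)

section \<open>Mixtures and local operations\<close>

text \<open>An ensemble of unnormalised vectors for a density matrix. Kraus operators send vectors
  to vectors, so a run can be followed on ensembles instead of matrices. Vectors are functions, so
  that regrouping tensor factors is plain index arithmetic.\<close>

definition mixture :: "nat \<Rightarrow> (nat \<Rightarrow> complex) list \<Rightarrow> complex mat" where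
  "mixture n fs = mat n n (\<lambda>(i, j). \<Sum>f\<leftarrow>fs. f i * cnj (f j))"

definition norm2 :: "nat \<Rightarrow> (nat \<Rightarrow> complex) \<Rightarrow> real" where
  "norm2 n f = (\<Sum>i<n. (cmod (f i))\<^sup>2)"

text \<open>The square of the Frobenius norm, just as \<open>norm2\<close> is the square of the
  Euclidean norm.\<close>

definition frob :: "nat \<Rightarrow> nat \<Rightarrow> (nat \<Rightarrow> nat \<Rightarrow> complex) \<Rightarrow> real" where
  "frob m n X = (\<Sum>i<m. \<Sum>j<n. (cmod (X i j))\<^sup>2)"

lemma mixture_carrier: "mixture n fs \<in> carrier_mat n n"
  by (simp add: mixture_def)

lemma mixture_index:
  "i < n \<Longrightarrow> j < n \<Longrightarrow> mixture n fs $$ (i, j) = (\<Sum>f\<leftarrow>fs. f i * cnj (f j))"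
  by (simp add: mixture_def)

lemma mixture_cong:
  assumes "\<And>l i. l \<in> set L \<Longrightarrow> i < n \<Longrightarrow> F l i = G l i"
  shows "mixture n (map F L) = mixture n (map G L)"
  unfolding mixture_def
  by (rule cong_mat) (auto simp: assms comp_def intro!: arg_cong[where f = sum_list] map_cong)

lemma trace_mixture: "mat_trace (mixture n fs) = of_real (\<Sum>f\<leftarrow>fs. norm2 n f)"
proof -
  have "mat_trace (mixture n fs) = (\<Sum>i<n. \<Sum>f\<leftarrow>fs. f i * cnj (f i))"
    by (simp add: mat_trace_def mixture_def)
  also have "\<dots> = (\<Sum>f\<leftarrow>fs. \<Sum>i<n. f i * cnj (f i))"
    by (simp add: sum_list_sum_swap)
  also have "\<dots> = (\<Sum>f\<leftarrow>fs. of_real (norm2 n f))"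
    by (simp add: norm2_def complex_norm_square del: of_real_power)
  finally show ?thesis
    by (simp add: of_real_sum_list)
qed

text \<open>Each term \<open>|f><f|\<close> becomes \<open>|K f><K f|\<close>, so the new ensemble
  lists all pairs of a Kraus operator and an old vector.\<close>

lemma apply_kraus_mixture:
  assumes "\<And>K. K \<in> set Ks \<Longrightarrow> K \<in> carrier_mat m n"
  shows "apply_kraus m Ks (mixture n fs)
    = mixture m (map (\<lambda>(K, f) i. \<Sum>p<n. K $$ (i, p) * f p) (List.product Ks fs))"
proof -
  have *: "(K * mixture n fs * mat_adjoint K) $$ (i, j)
      = (\<Sum>f\<leftarrow>fs. (\<Sum>p<n. K $$ (i, p) * f p) * cnj (\<Sum>p<n. K $$ (j, p) * f p))"
    if K: "K \<in> carrier_mat m n" and ij: "i < m" "j < m" for K i j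
  proof -
    have "(K * mixture n fs * mat_adjoint K) $$ (i, j)
        = (\<Sum>q<n. (\<Sum>p<n. K $$ (i, p) * (\<Sum>f\<leftarrow>fs. f p * cnj (f q))) * cnj (K $$ (j, q)))"
      using K ij mixture_carrier[of n fs]
      by (subst mult_index_sum[of _ m n _ m])
        (auto simp: mat_adjoint_carrier mat_adjoint_index mult_index_sum[of K m n _ n] mixture_index
          simp del: index_mult_mat intro!: sum.cong)
    also have "\<dots> = (\<Sum>q<n. \<Sum>p<n. \<Sum>f\<leftarrow>fs. K $$ (i, p) * f p * cnj (K $$ (j, q) * f q))"
      by (simp add: sum_distrib_right sum_distrib_left sum_list_const_mult[symmetric]
          sum_list_mult_const[symmetric] mult_ac)
    also have "\<dots> = (\<Sum>f\<leftarrow>fs. \<Sum>q<n. \<Sum>p<n. K $$ (i, p) * f p * cnj (K $$ (j, q) * f q))"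
      by (simp add: sum_list_sum_swap)
    also have "\<dots> = (\<Sum>f\<leftarrow>fs. (\<Sum>p<n. K $$ (i, p) * f p) * cnj (\<Sum>p<n. K $$ (j, p) * f p))"
      by (simp add: sum_distrib_right sum_distrib_left)
    finally show ?thesis .
  qed
  show ?thesis
    unfolding apply_kraus_def sum_mats_def mixture_def[of m]
    by (rule cong_mat)
      (auto simp: comp_def case_prod_beta sum_list_product * assms intro!: arg_cong[where f = sum_list] map_cong)
qed

section \<open>Kraus operators acting on one tensor factor\<close>

lemma tensor_mat_carrier:
  "A \<in> carrier_mat m n \<Longrightarrow> B \<in> carrier_mat k l \<Longrightarrow> tensor_mat A B \<in> carrier_mat (m * k) (n * l)"
  by (auto simp: tensor_mat_def)

lemma tensor_one_apply:
  assumes "K \<in> carrier_mat d n" "i < d * l"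
  shows "(\<Sum>p<n * l. tensor_mat K (1\<^sub>m l) $$ (i, p) * f p)
    = (\<Sum>a<n. K $$ (i div l, a) * f (a * l + i mod l))"
proof -
  have l: "0 < l"
    using assms(2) by (cases l) auto
  have "tensor_mat K (1\<^sub>m l) $$ (i, a * l + b) = (if b = i mod l then K $$ (i div l, a) else 0)"
    if "a < n" "b < l" for a b
    using that assms l nat_index_less[OF that]
    by (auto simp: tensor_mat_def less_mult_imp_div_less)
  then show ?thesis
    using l by (simp add: sum_lessThan_mult if_distrib[where f = "\<lambda>x. x * _"] sum.delta cong: if_cong)
qed

lemma one_tensor_apply:
  assumes "K \<in> carrier_mat d l" "i < n * d"
  shows "(\<Sum>p<n * l. tensor_mat (1\<^sub>m n) K $$ (i, p) * f p)
    = (\<Sum>b<l. K $$ (i mod d, b) * f (i div d * l + b))"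
proof -
  have d: "0 < d"
    using assms(2) by (cases d) auto
  have "tensor_mat (1\<^sub>m n) K $$ (i, a * l + b) = (if a = i div d then K $$ (i mod d, b) else 0)"
    if "a < n" "b < l" for a b
    using that assms d nat_index_less[OF that]
    by (auto simp: tensor_mat_def less_mult_imp_div_less)
  then have "(\<Sum>p<n * l. tensor_mat (1\<^sub>m n) K $$ (i, p) * f p)
      = (\<Sum>a<n. if a = i div d then (\<Sum>b<l. K $$ (i mod d, b) * f (a * l + b)) else 0)"
    by (subst sum_lessThan_mult, intro sum.cong refl) auto
  then show ?thesis
    using assms(2) by (simp add: sum.delta less_mult_imp_div_less)
qed

lemma apply_kraus_Alice:
  assumes "\<And>K. K \<in> set Ks \<Longrightarrow> K \<in> carrier_mat d n"
  shows "apply_kraus (d * l) (map (\<lambda>K. tensor_mat K (1\<^sub>m l)) Ks) (mixture (n * l) fs)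
    = mixture (d * l)
        (map (\<lambda>(K, f) i. \<Sum>a<n. K $$ (i div l, a) * f (a * l + i mod l)) (List.product Ks fs))"
proof -
  have "apply_kraus (d * l) (map (\<lambda>K. tensor_mat K (1\<^sub>m l)) Ks) (mixture (n * l) fs)
      = mixture (d * l) (map (\<lambda>(K, f) i. \<Sum>p<n * l. tensor_mat K (1\<^sub>m l) $$ (i, p) * f p) (List.product Ks fs))"
    using assms by (subst apply_kraus_mixture)
      (auto intro!: tensor_mat_carrier simp: product_concat_map comp_def map_concat)
  also have "\<dots> = mixture (d * l)
        (map (\<lambda>(K, f) i. \<Sum>a<n. K $$ (i div l, a) * f (a * l + i mod l)) (List.product Ks fs))"
    by (rule mixture_cong) (auto simp: tensor_one_apply[OF assms])
  finally show ?thesis .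
qed

lemma apply_kraus_Bob:
  assumes "\<And>K. K \<in> set Ks \<Longrightarrow> K \<in> carrier_mat d l"
  shows "apply_kraus (n * d) (map (\<lambda>K. tensor_mat (1\<^sub>m n) K) Ks) (mixture (n * l) fs)
    = mixture (n * d)
        (map (\<lambda>(K, f) i. \<Sum>b<l. K $$ (i mod d, b) * f (i div d * l + b)) (List.product Ks fs))"
proof -
  have "apply_kraus (n * d) (map (\<lambda>K. tensor_mat (1\<^sub>m n) K) Ks) (mixture (n * l) fs)
      = mixture (n * d) (map (\<lambda>(K, f) i. \<Sum>p<n * l. tensor_mat (1\<^sub>m n) K $$ (i, p) * f p) (List.product Ks fs))"
    using assms by (subst apply_kraus_mixture)
      (auto intro!: tensor_mat_carrier simp: product_concat_map comp_def map_concat)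
  also have "\<dots> = mixture (n * d)
        (map (\<lambda>(K, f) i. \<Sum>b<l. K $$ (i mod d, b) * f (i div d * l + b)) (List.product Ks fs))"
    by (rule mixture_cong) (auto simp: one_tensor_apply[OF assms])
  finally show ?thesis .
qed

text \<open>Stacked on top of each other, the Kraus operators of all outcomes form an isometry; this
  is what the completeness relation says. Squared norms are therefore preserved once summed over
  outcomes and Kraus operators.\<close>

lemma instrument_isometry:
  assumes "instrument n ops"
  shows "(\<Sum>(d, Ks)\<leftarrow>ops. \<Sum>K\<leftarrow>Ks. norm2 d (\<lambda>r. \<Sum>a<n. K $$ (r, a) * g a)) = norm2 n g"
proof -
  have car: "K \<in> carrier_mat d n" if "(d, Ks) \<in> set ops" "K \<in> set Ks" for d Ks K
    using assms that by (auto simp: instrument_def)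
  have one: "(\<Sum>(d, Ks)\<leftarrow>ops. \<Sum>K\<leftarrow>Ks. (mat_adjoint K * K) $$ (b, a)) = (if b = a then 1 else 0)"
    if "a < n" "b < n" for a b
  proof -
    have "sum_mats n n (map (\<lambda>K. mat_adjoint K * K) (concat (map snd ops))) $$ (b, a) = 1\<^sub>m n $$ (b, a)"
      using assms by (simp add: instrument_def)
    then show ?thesis
      using that by (simp add: sum_mats_def comp_def sum_list_concat_map case_prod_unfold
          del: index_mult_mat split del: if_split)
  qed
  have sq: "complex_of_real (norm2 d (\<lambda>r. \<Sum>a<n. K $$ (r, a) * g a))
      = (\<Sum>a<n. \<Sum>b<n. (mat_adjoint K * K) $$ (b, a) * (g a * cnj (g b)))"
    if K: "K \<in> carrier_mat d n" for d K
  proof -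
    have "complex_of_real (norm2 d (\<lambda>r. \<Sum>a<n. K $$ (r, a) * g a))
        = (\<Sum>r<d. \<Sum>a<n. \<Sum>b<n. cnj (K $$ (r, b)) * K $$ (r, a) * (g a * cnj (g b)))"
      by (simp add: norm2_def complex_norm_square sum_product mult_ac flip: of_real_power)
    also have "\<dots> = (\<Sum>a<n. \<Sum>b<n. \<Sum>r<d. cnj (K $$ (r, b)) * K $$ (r, a) * (g a * cnj (g b)))"
      by (subst sum.swap, rule sum.cong[OF refl], rule sum.swap)
    also have "\<dots> = (\<Sum>a<n. \<Sum>b<n. (mat_adjoint K * K) $$ (b, a) * (g a * cnj (g b)))"
      using K mat_adjoint_carrier[OF K]
      by (auto simp: mult_index_sum[of _ n d _ n] mat_adjoint_index sum_distrib_right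
          simp del: index_mult_mat intro!: sum.cong)
    finally show ?thesis .
  qed
  have "complex_of_real (\<Sum>(d, Ks)\<leftarrow>ops. \<Sum>K\<leftarrow>Ks. norm2 d (\<lambda>r. \<Sum>a<n. K $$ (r, a) * g a))
      = (\<Sum>(d, Ks)\<leftarrow>ops. \<Sum>K\<leftarrow>Ks. complex_of_real (norm2 d (\<lambda>r. \<Sum>a<n. K $$ (r, a) * g a)))"
    by (simp add: case_prod_unfold of_real_sum_list)
  also have "\<dots> = (\<Sum>(d, Ks)\<leftarrow>ops. \<Sum>K\<leftarrow>Ks. \<Sum>a<n. \<Sum>b<n. (mat_adjoint K * K) $$ (b, a) * (g a * cnj (g b)))"
    by (auto simp: car sq simp del: index_mult_mat intro!: arg_cong[where f = sum_list] map_cong)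
  also have "\<dots> = (\<Sum>a<n. \<Sum>b<n. (\<Sum>(d, Ks)\<leftarrow>ops. \<Sum>K\<leftarrow>Ks. (mat_adjoint K * K) $$ (b, a)) * (g a * cnj (g b)))"
    by (simp add: case_prod_unfold sum_list_sum_swap sum_list_mult_const del: index_mult_mat)
  also have "\<dots> = (\<Sum>a<n. \<Sum>b<n. (if b = a then 1 else 0) * (g a * cnj (g b)))"
    by (intro sum.cong refl) (simp add: one del: index_mult_mat)
  also have "\<dots> = complex_of_real (norm2 n g)"
    by (simp add: norm2_def complex_norm_square if_distrib[where f = "\<lambda>x. x * _"]
        del: of_real_power cong: if_cong)
  finally show ?thesis
    using of_real_eq_iff by blast
qed

section \<open>The factorisation bound\<close>

text \<open>The state vector whose amplitude matrix, with rows for Alice and columns for Bob, is the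
  product X * Y of the pair. The inner dimension \<open>n\<close> is touched by neither party and
  stays fixed during a run; \<open>l\<close> is Bob's current dimension.\<close>

definition factored :: "nat \<Rightarrow> nat \<Rightarrow> (nat \<Rightarrow> nat \<Rightarrow> complex) \<times> (nat \<Rightarrow> nat \<Rightarrow> complex) \<Rightarrow> nat \<Rightarrow> complex" where
  "factored n l p i = (\<Sum>k<n. fst p (i div l) k * snd p k (i mod l))"

lemma norm2_mult_columns: "norm2 (m * l) f = (\<Sum>b<l. norm2 m (\<lambda>a. f (a * l + b)))"
  unfolding norm2_def sum_lessThan_mult by (rule sum.swap)

lemma norm2_mult_rows: "norm2 (m * l) f = (\<Sum>a<m. norm2 l (\<lambda>b. f (a * l + b)))"
  unfolding norm2_def sum_lessThan_mult ..

lemma frob_columns: "frob m n X = (\<Sum>j<n. norm2 m (\<lambda>i. X i j))"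
  unfolding norm2_def frob_def by (rule sum.swap)

lemma frob_rows: "frob m n X = (\<Sum>i<m. norm2 n (X i))"
  unfolding norm2_def frob_def ..

lemma frob_nonneg: "0 \<le> frob m n X"
  by (simp add: frob_def sum_nonneg)

text \<open>The isometry applied to a family of vectors; \<open>J\<close> will run over the columns
  of a matrix for Alice and over its rows for Bob.\<close>

lemma instrument_isometry_sum:
  assumes "instrument n (map (\<lambda>(d, Ks, P). (d, Ks)) bs)"
  shows "(\<Sum>(d, Ks, P)\<leftarrow>bs. \<Sum>K\<leftarrow>Ks. \<Sum>j\<in>J. norm2 d (\<lambda>r. \<Sum>a<n. K $$ (r, a) * G j a))
    = (\<Sum>j\<in>J. norm2 n (G j))"
proof -
  have "(\<Sum>(d, Ks, P)\<leftarrow>bs. \<Sum>K\<leftarrow>Ks. norm2 d (\<lambda>r. \<Sum>a<n. K $$ (r, a) * g a)) = norm2 n g" for g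
    using instrument_isometry[OF assms, of g] by (simp add: case_prod_unfold comp_def)
  then show ?thesis
    by (simp add: case_prod_unfold sum_list_sum_swap)
qed

text \<open>A quantity conserved for each vector of an ensemble is conserved for the whole ensemble,
  by exchanging the sums over vectors and over Kraus operators.\<close>

lemma sum_branches_product:
  fixes w :: "nat \<Rightarrow> complex mat \<Rightarrow> 'b \<Rightarrow> real"
  assumes "\<And>p. p \<in> set L \<Longrightarrow> (\<Sum>(d, Ks, P)\<leftarrow>bs. \<Sum>K\<leftarrow>Ks. w d K p) = v p"
  shows "(\<Sum>(d, Ks, P)\<leftarrow>bs. \<Sum>(K, p)\<leftarrow>List.product Ks L. w d K p) = (\<Sum>p\<leftarrow>L. v p)"
proof -
  have "(\<Sum>(d, Ks, P)\<leftarrow>bs. \<Sum>(K, p)\<leftarrow>List.product Ks L. w d K p)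
      = (\<Sum>b\<leftarrow>bs. \<Sum>p\<leftarrow>L. \<Sum>K\<leftarrow>fst (snd b). w (fst b) K p)"
    by (simp add: case_prod_unfold sum_list_product sum_list_swap[of _ L])
  also have "\<dots> = (\<Sum>p\<leftarrow>L. \<Sum>b\<leftarrow>bs. \<Sum>K\<leftarrow>fst (snd b). w (fst b) K p)"
    by (rule sum_list_swap)
  also have "\<dots> = (\<Sum>p\<leftarrow>L. v p)"
    using assms by (auto simp: case_prod_unfold intro!: arg_cong[where f = sum_list] map_cong)
  finally show ?thesis .
qed

section \<open>The Cauchy-Schwarz bound on the Bell weight\<close>

lemma bell_overlap_le:
  "(\<Sum>x<rA. \<Sum>y<rB. (cmod (\<Sum>c<2. factored n (2 * rB) p ((c * rA + x) * (2 * rB) + (c * rB + y))))\<^sup>2)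
    \<le> frob (2 * rA) n (fst p) * frob n (2 * rB) (snd p)"
proof -
  obtain X Y where p: "p = (X, Y)"
    by fastforce
  define S where "S = {..<2::nat} \<times> {..<n}"
  \<comment> \<open>For fixed \<open>x\<close> and \<open>y\<close> the overlap with
    \<open>|00> + |11>\<close> is one scalar product over pairs \<open>(c, k)\<close>.
    Cauchy-Schwarz bounds it by a term in \<open>x\<close> alone times a term in \<open>y\<close>
    alone, so the sum over both factorises afterwards.\<close>
  have "(cmod (\<Sum>c<2. factored n (2 * rB) p ((c * rA + x) * (2 * rB) + (c * rB + y))))\<^sup>2
      \<le> (\<Sum>c<2. \<Sum>k<n. (cmod (X (c * rA + x) k))\<^sup>2) * (\<Sum>c<2. \<Sum>k<n. (cmod (Y k (c * rB + y)))\<^sup>2)"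
    if "y < rB" for x y
  proof -
    have "factored n (2 * rB) p ((c * rA + x) * (2 * rB) + (c * rB + y))
        = (\<Sum>k<n. X (c * rA + x) k * Y k (c * rB + y))" if "c < 2" for c
      using nat_index_less[OF that \<open>y < rB\<close>] by (simp add: factored_def p)
    then have "(\<Sum>c<2. factored n (2 * rB) p ((c * rA + x) * (2 * rB) + (c * rB + y)))
        = (\<Sum>(c, k)\<in>S. X (c * rA + x) k * Y k (c * rB + y))"
      unfolding S_def by (subst sum.cartesian_product[symmetric]) simp
    then show ?thesis
      using cmod_sum_mult_squared_le[of "\<lambda>(c, k). X (c * rA + x) k" "\<lambda>(c, k). Y k (c * rB + y)" S]
      by (simp add: case_prod_unfold S_def sum.cartesian_product)
  qed
  then have "(\<Sum>x<rA. \<Sum>y<rB. (cmod (\<Sum>c<2. factored n (2 * rB) p ((c * rA + x) * (2 * rB) + (c * rB + y))))\<^sup>2)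
      \<le> (\<Sum>x<rA. \<Sum>y<rB. (\<Sum>c<2. \<Sum>k<n. (cmod (X (c * rA + x) k))\<^sup>2) * (\<Sum>c<2. \<Sum>k<n. (cmod (Y k (c * rB + y)))\<^sup>2))"
    by (intro sum_mono) auto
  also have "\<dots> = (\<Sum>x<rA. \<Sum>c<2. \<Sum>k<n. (cmod (X (c * rA + x) k))\<^sup>2)
      * (\<Sum>y<rB. \<Sum>c<2. \<Sum>k<n. (cmod (Y k (c * rB + y)))\<^sup>2)"
    by (simp only: sum_product)
  also have "(\<Sum>x<rA. \<Sum>c<2. \<Sum>k<n. (cmod (X (c * rA + x) k))\<^sup>2) = frob (2 * rA) n X"
    unfolding frob_def sum_lessThan_mult by (rule sum.swap)
  also have "(\<Sum>y<rB. \<Sum>c<2. \<Sum>k<n. (cmod (Y k (c * rB + y)))\<^sup>2) = frob n (2 * rB) Y"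
    unfolding frob_columns norm2_def sum_lessThan_mult by (rule sum.swap)
  finally show ?thesis
    by (simp add: p)
qed

lemma bell_entries:
  "i \<in> {0, 3} \<Longrightarrow> j \<in> {0, 3} \<Longrightarrow> pure_state bell $$ (i, j) = 1 / 2"
proof -
  have "bell $ k = 1 / complex_of_real (sqrt 2)" if "k \<in> {0, 3}" for k
    using that unfolding bell_def vec_of_list_index by auto
  moreover assume "i \<in> {0, 3}" "j \<in> {0, 3}"
  moreover have "dim_vec bell = 4"
    by (simp add: bell_def)
  ultimately show ?thesis
    by (auto simp: pure_state_def simp flip: of_real_mult)
qed

text \<open>The four corner entries add up to the expectation of \<open>R\<close> in the
  unnormalised vector \<open>|00> + |11>\<close>, which is twice the weight of \<open>R\<close> on
  the Bell state. Expanding the partial trace turns it into squared overlaps of the ensemble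
  vectors.\<close>

lemma bell_fidelity_mixture:
  assumes "R = reduced_AB rA rB (mixture ((2 * rA) * (2 * rB)) fs)"
  shows "R $$ (0, 0) + R $$ (0, 3) + R $$ (3, 0) + R $$ (3, 3)
    = of_real (\<Sum>f\<leftarrow>fs. \<Sum>x<rA. \<Sum>y<rB. (cmod (\<Sum>c<2. f ((c * rA + x) * (2 * rB) + (c * rB + y))))\<^sup>2)"
proof -
  define h where "h c x y = (c * rA + x) * (2 * rB) + (c * rB + y)" for c x y
  have less: "h c x y < (2 * rA) * (2 * rB)" if "c < 2" "x < rA" "y < rB" for c x y
    unfolding h_def by (intro nat_index_less that)
  have R: "R $$ (3 * c, 3 * c') = (\<Sum>f\<leftarrow>fs. \<Sum>x<rA. \<Sum>y<rB. f (h c x y) * cnj (f (h c' x y)))"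
    if "c < 2" "c' < 2" for c c'
  proof -
    \<comment> \<open>The basis vector \<open>|cc>\<close> of two qubits has index
      \<open>3 * c\<close>, which lets one formula cover all four corners.\<close>
    have *: "3 * k < 4" "3 * k div 2 = k" "3 * k mod 2 = k" if "k < 2" for k :: nat
      using less_2_cases[OF that] by auto
    have "R $$ (3 * c, 3 * c') = (\<Sum>x<rA. \<Sum>y<rB. mixture ((2 * rA) * (2 * rB)) fs $$ (h c x y, h c' x y))"
      by (simp add: assms reduced_AB_def Let_def h_def * that)
    also have "\<dots> = (\<Sum>x<rA. \<Sum>y<rB. \<Sum>f\<leftarrow>fs. f (h c x y) * cnj (f (h c' x y)))"
      by (intro sum.cong refl mixture_index less that) auto
    finally show ?thesis
      by (simp add: sum_list_sum_swap)
  qed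
  have two: "{..<2::nat} = {0, 1}"
    by auto
  have "R $$ (0, 0) + R $$ (0, 3) + R $$ (3, 0) + R $$ (3, 3) = (\<Sum>c<2. \<Sum>c'<2. R $$ (3 * c, 3 * c'))"
    by (simp add: two add.assoc)
  also have "\<dots> = (\<Sum>c<2. \<Sum>c'<2. \<Sum>f\<leftarrow>fs. \<Sum>x<rA. \<Sum>y<rB. f (h c x y) * cnj (f (h c' x y)))"
    by (intro sum.cong refl R) auto
  also have "\<dots> = (\<Sum>f\<leftarrow>fs. \<Sum>c<2. \<Sum>c'<2. \<Sum>x<rA. \<Sum>y<rB. f (h c x y) * cnj (f (h c' x y)))"
    by (simp add: sum_list_sum_swap)
  also have "\<dots> = (\<Sum>f\<leftarrow>fs. \<Sum>x<rA. \<Sum>y<rB. (\<Sum>c<2. f (h c x y)) * cnj (\<Sum>c<2. f (h c x y)))"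
    by (simp add: two sum.distrib distrib_left distrib_right add_ac)
  finally show ?thesis
    by (simp add: h_def of_real_sum_list complex_norm_square del: of_real_power)
qed

text \<open>At a leaf the state of AB is exactly the Bell state, so twice its Bell weight is twice
  its trace, while \<open>bell_overlap_le\<close> bounds the same number by the product of Frobenius
  norms.\<close>

lemma restores_Stop_bound:
  assumes "restores dA dB Stop (mixture (dA * dB) (map (factored n dB) L))"
  shows "2 * (\<Sum>p\<leftarrow>L. norm2 (dA * dB) (factored n dB p))
    \<le> (\<Sum>p\<leftarrow>L. frob dA n (fst p) * frob n dB (snd p))"
proof -
  define \<sigma> where "\<sigma> = mixture (dA * dB) (map (factored n dB) L)"
  define T where "T = (\<Sum>p\<leftarrow>L. norm2 (dA * dB) (factored n dB p))"
  have tr: "mat_trace \<sigma> = of_real T"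
    by (simp add: \<sigma>_def trace_mixture T_def comp_def)
  show ?thesis
  proof (cases "T = 0")
    \<comment> \<open>A branch of probability zero satisfies no restoration condition, but then the
      left side vanishes and the right side is nonnegative.\<close>
    case True
    then show ?thesis
      by (auto simp: T_def intro!: sum_list_nonneg mult_nonneg_nonneg frob_nonneg)
  next
    case False
    with assms tr obtain rA rB where d: "dA = 2 * rA" "dB = 2 * rB"
      and R: "(1 / mat_trace \<sigma>) \<cdot>\<^sub>m reduced_AB rA rB \<sigma> = pure_state bell"
      by (auto simp: restores_def \<sigma>_def)
    have ent: "reduced_AB rA rB \<sigma> $$ (i, j) = of_real T * pure_state bell $$ (i, j)"
      if "i < 4" "j < 4" for i j
      using that False unfolding R[symmetric] tr by (simp add: reduced_AB_def)
    \<comment> \<open>Each of the four corners equals T / 2.\<close>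
    have "complex_of_real (2 * T) = reduced_AB rA rB \<sigma> $$ (0, 0) + reduced_AB rA rB \<sigma> $$ (0, 3)
        + reduced_AB rA rB \<sigma> $$ (3, 0) + reduced_AB rA rB \<sigma> $$ (3, 3)"
      by (simp add: ent bell_entries)
    also have "\<dots> = of_real (\<Sum>f\<leftarrow>map (factored n dB) L. \<Sum>x<rA. \<Sum>y<rB.
        (cmod (\<Sum>c<2. f ((c * rA + x) * (2 * rB) + (c * rB + y))))\<^sup>2)"
      by (rule bell_fidelity_mixture) (simp only: \<sigma>_def d)
    finally have "complex_of_real (2 * T)
        = of_real (\<Sum>p\<leftarrow>L. \<Sum>x<rA. \<Sum>y<rB. (cmod (\<Sum>c<2. factored n dB p ((c * rA + x) * (2 * rB) + (c * rB + y))))\<^sup>2)"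
      by (simp only: map_map comp_def)
    then have "2 * T = (\<Sum>p\<leftarrow>L. \<Sum>x<rA. \<Sum>y<rB. (cmod (\<Sum>c<2. factored n dB p ((c * rA + x) * (2 * rB) + (c * rB + y))))\<^sup>2)"
      by (simp only: of_real_eq_iff)
    also have "\<dots> \<le> (\<Sum>p\<leftarrow>L. frob dA n (fst p) * frob n dB (snd p))"
      unfolding d by (intro sum_list_mono bell_overlap_le)
    finally show ?thesis
      by (simp add: T_def)
  qed
qed

section \<open>Propagation of a factorisation through a protocol\<close>

lemma apply_kraus_Alice_factored:
  assumes "\<And>K. K \<in> set Ks \<Longrightarrow> K \<in> carrier_mat d dA"
  shows "apply_kraus (d * dB) (map (\<lambda>K. tensor_mat K (1\<^sub>m dB)) Ks)
      (mixture (dA * dB) (map (factored n dB) L))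
    = mixture (d * dB) (map (factored n dB)
        (map (\<lambda>(K, p). (\<lambda>r k. \<Sum>a<dA. K $$ (r, a) * fst p a k, snd p)) (List.product Ks L)))"
proof -
  \<comment> \<open>Associativity: K * (X * Y) = (K * X) * Y.\<close>
  have "(\<Sum>a<dA. K $$ (i div dB, a) * factored n dB p (a * dB + i mod dB))
      = factored n dB (\<lambda>r k. \<Sum>a<dA. K $$ (r, a) * fst p a k, snd p) i" if "i < d * dB" for K p i
  proof -
    have "0 < dB"
      using that by (cases dB) auto
    then have "(\<Sum>a<dA. K $$ (i div dB, a) * factored n dB p (a * dB + i mod dB))
        = (\<Sum>a<dA. \<Sum>k<n. K $$ (i div dB, a) * fst p a k * snd p k (i mod dB))"
      by (simp add: factored_def sum_distrib_left mult.assoc)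
    also have "\<dots> = (\<Sum>k<n. \<Sum>a<dA. K $$ (i div dB, a) * fst p a k * snd p k (i mod dB))"
      by (rule sum.swap)
    finally show ?thesis
      by (simp add: factored_def sum_distrib_right)
  qed
  moreover have "map (\<lambda>(K, f) i. \<Sum>a<dA. K $$ (i div dB, a) * f (a * dB + i mod dB)) (List.product Ks (map F L))
      = map (\<lambda>(K, p) i. \<Sum>a<dA. K $$ (i div dB, a) * F p (a * dB + i mod dB)) (List.product Ks L)" for F
    by (simp add: product_concat_map map_concat comp_def)
  ultimately show ?thesis
    by (subst apply_kraus_Alice[OF assms]) (auto simp: comp_def intro!: mixture_cong)
qed

lemma apply_kraus_Bob_factored:
  assumes "\<And>K. K \<in> set Ks \<Longrightarrow> K \<in> carrier_mat d dB"
  shows "apply_kraus (dA * d) (map (\<lambda>K. tensor_mat (1\<^sub>m dA) K) Ks)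
      (mixture (dA * dB) (map (factored n dB) L))
    = mixture (dA * d) (map (factored n d)
        (map (\<lambda>(K, p). (fst p, \<lambda>k r. \<Sum>b<dB. K $$ (r, b) * snd p k b)) (List.product Ks L)))"
proof -
  \<comment> \<open>Bob acts on the column index, so Y is multiplied from the right by the transpose
    of K.\<close>
  have "(\<Sum>b<dB. K $$ (i mod d, b) * factored n dB p (i div d * dB + b))
      = factored n d (fst p, \<lambda>k r. \<Sum>b<dB. K $$ (r, b) * snd p k b) i" for K p i
  proof -
    have "(\<Sum>b<dB. K $$ (i mod d, b) * factored n dB p (i div d * dB + b))
        = (\<Sum>b<dB. \<Sum>k<n. fst p (i div d) k * (K $$ (i mod d, b) * snd p k b))"
      by (intro sum.cong refl) (simp add: factored_def sum_distrib_left mult_ac)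
    also have "\<dots> = (\<Sum>k<n. \<Sum>b<dB. fst p (i div d) k * (K $$ (i mod d, b) * snd p k b))"
      by (rule sum.swap)
    finally show ?thesis
      by (simp add: factored_def sum_distrib_left)
  qed
  moreover have "map (\<lambda>(K, f) i. \<Sum>b<dB. K $$ (i mod d, b) * f (i div d * dB + b)) (List.product Ks (map F L))
      = map (\<lambda>(K, p) i. \<Sum>b<dB. K $$ (i mod d, b) * F p (i div d * dB + b)) (List.product Ks L)" for F
    by (simp add: product_concat_map map_concat comp_def)
  ultimately show ?thesis
    by (subst apply_kraus_Bob[OF assms]) (auto simp: comp_def intro!: mixture_cong)
qed

text \<open>Induction on the protocol tree. Leaves satisfy the inequality, and at a node both sides,
  summed over all branches, equal their values before the instrument. \<open>L\<close> is arbitrary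
  because every branch continues with its own ensemble.\<close>

lemma restores_bound:
  assumes "locc dA dB P"
    and "restores dA dB P (mixture (dA * dB) (map (factored n dB) L))"
  shows "2 * (\<Sum>p\<leftarrow>L. norm2 (dA * dB) (factored n dB p))
    \<le> (\<Sum>p\<leftarrow>L. frob dA n (fst p) * frob n dB (snd p))"
  using assms
proof (induction dA dB P arbitrary: L rule: locc.induct)
  case (1 dA dB)
  then show ?case
    by (intro restores_Stop_bound)
next
  case (2 dA dB bs)
  let ?f = "\<lambda>K p. (\<lambda>r k. \<Sum>a<dA. K $$ (r, a) * fst p a k, snd p)"
  have inst: "instrument dA (map (\<lambda>(d, Ks, P). (d, Ks)) bs)"
    using 2(2) by simp
  have car: "K \<in> carrier_mat d dA" if "(d, Ks, P) \<in> set bs" "K \<in> set Ks" for d Ks P K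
    using inst that by (force simp: instrument_def)
  have branch: "2 * (\<Sum>(K, p)\<leftarrow>List.product Ks L. norm2 (d * dB) (factored n dB (?f K p)))
      \<le> (\<Sum>(K, p)\<leftarrow>List.product Ks L. frob d n (fst (?f K p)) * frob n dB (snd (?f K p)))"
    if b: "(d, Ks, P) \<in> set bs" for d Ks P
  proof -
    have l: "locc d dB P"
      using 2(2) b by auto
    have "restores d dB P (apply_kraus (d * dB) (map (\<lambda>K. tensor_mat K (1\<^sub>m dB)) Ks)
      (mixture (dA * dB) (map (factored n dB) L)))"
      using 2(3) b by (fastforce simp: restores_def)
    then have "restores d dB P (mixture (d * dB) (map (factored n dB) (map (\<lambda>(K, p). ?f K p) (List.product Ks L))))"
      using car[OF b] by (simp only: apply_kraus_Alice_factored)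
    from "2.IH"[OF b refl refl l this] show ?thesis
      by (simp add: case_prod_unfold comp_def)
  qed
  \<comment> \<open>Conservation of probability: for each fixed index of Bob, Alice's isometry acts
    on one column of the amplitude matrix.\<close>
  have tr: "(\<Sum>(d, Ks, P)\<leftarrow>bs. \<Sum>(K, p)\<leftarrow>List.product Ks L. norm2 (d * dB) (factored n dB (?f K p)))
      = (\<Sum>p\<leftarrow>L. norm2 (dA * dB) (factored n dB p))"
  proof (rule sum_branches_product)
    fix p
    have "factored n dB (?f K p) (r * dB + b) = (\<Sum>a<dA. K $$ (r, a) * factored n dB p (a * dB + b))"
      if "b < dB" for K r b
      using that
      by (simp add: factored_def sum_distrib_left sum_distrib_right mult.assoc) (rule sum.swap)
    then show "(\<Sum>(d, Ks, P)\<leftarrow>bs. \<Sum>K\<leftarrow>Ks. norm2 (d * dB) (factored n dB (?f K p)))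
        = norm2 (dA * dB) (factored n dB p)"
      using instrument_isometry_sum[OF inst, where J = "{..<dB}" and G = "\<lambda>b a. factored n dB p (a * dB + b)"]
      by (simp add: norm2_mult_columns)
  qed
  \<comment> \<open>Only X changes, column by column under the isometry; the norm of Y is a constant
    factor.\<close>
  have fr: "(\<Sum>(d, Ks, P)\<leftarrow>bs. \<Sum>(K, p)\<leftarrow>List.product Ks L. frob d n (fst (?f K p)) * frob n dB (snd (?f K p)))
      = (\<Sum>p\<leftarrow>L. frob dA n (fst p) * frob n dB (snd p))"
  proof (rule sum_branches_product)
    fix p
    show "(\<Sum>(d, Ks, P)\<leftarrow>bs. \<Sum>K\<leftarrow>Ks. frob d n (fst (?f K p)) * frob n dB (snd (?f K p)))
        = frob dA n (fst p) * frob n dB (snd p)"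
      using instrument_isometry_sum[OF inst, where J = "{..<n}" and G = "\<lambda>k a. fst p a k"]
      by (simp add: frob_columns[of _ n "fst _"] frob_columns[of _ _ "\<lambda>r k. _ r k"] case_prod_unfold sum_list_mult_const)
  qed
  have "2 * (\<Sum>(d, Ks, P)\<leftarrow>bs. \<Sum>(K, p)\<leftarrow>List.product Ks L. norm2 (d * dB) (factored n dB (?f K p)))
     = (\<Sum>(d, Ks, P)\<leftarrow>bs. 2 * (\<Sum>(K, p)\<leftarrow>List.product Ks L. norm2 (d * dB) (factored n dB (?f K p))))"
    by (simp add: case_prod_unfold sum_list_const_mult)
  also have "\<dots> \<le> (\<Sum>(d, Ks, P)\<leftarrow>bs. \<Sum>(K, p)\<leftarrow>List.product Ks L. frob d n (fst (?f K p)) * frob n dB (snd (?f K p)))"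
    using branch by (intro sum_list_mono) (auto simp del: fst_conv snd_conv)
  finally show ?case
    unfolding tr fr .
next
  case (3 dA dB bs)
  let ?f = "\<lambda>K p. (fst p, \<lambda>k r. \<Sum>b<dB. K $$ (r, b) * snd p k b)"
  have inst: "instrument dB (map (\<lambda>(d, Ks, P). (d, Ks)) bs)"
    using 3(2) by simp
  have car: "K \<in> carrier_mat d dB" if "(d, Ks, P) \<in> set bs" "K \<in> set Ks" for d Ks P K
    using inst that by (force simp: instrument_def)
  have branch: "2 * (\<Sum>(K, p)\<leftarrow>List.product Ks L. norm2 (dA * d) (factored n d (?f K p)))
      \<le> (\<Sum>(K, p)\<leftarrow>List.product Ks L. frob dA n (fst (?f K p)) * frob n d (snd (?f K p)))"
    if b: "(d, Ks, P) \<in> set bs" for d Ks P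
  proof -
    have l: "locc dA d P"
      using 3(2) b by auto
    have "restores dA d P (apply_kraus (dA * d) (map (\<lambda>K. tensor_mat (1\<^sub>m dA) K) Ks)
      (mixture (dA * dB) (map (factored n dB) L)))"
      using 3(3) b by (fastforce simp: restores_def)
    then have "restores dA d P (mixture (dA * d) (map (factored n d) (map (\<lambda>(K, p). ?f K p) (List.product Ks L))))"
      using car[OF b] by (simp only: apply_kraus_Bob_factored)
    from "3.IH"[OF b refl refl l this] show ?thesis
      by (simp add: case_prod_unfold comp_def)
  qed
  have tr: "(\<Sum>(d, Ks, P)\<leftarrow>bs. \<Sum>(K, p)\<leftarrow>List.product Ks L. norm2 (dA * d) (factored n d (?f K p)))
      = (\<Sum>p\<leftarrow>L. norm2 (dA * dB) (factored n dB p))"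
  proof (rule sum_branches_product)
    fix p
    have "norm2 d (\<lambda>r. factored n d (?f K p) (a * d + r))
        = norm2 d (\<lambda>r. \<Sum>b<dB. K $$ (r, b) * factored n dB p (a * dB + b))" for K a d
    proof -
      have "factored n d (?f K p) (a * d + r) = (\<Sum>b<dB. K $$ (r, b) * factored n dB p (a * dB + b))"
        if "r < d" for r
        using that
        by (simp add: factored_def sum_distrib_left mult_ac) (rule sum.swap)
      then show ?thesis
        by (simp add: norm2_def)
    qed
    then show "(\<Sum>(d, Ks, P)\<leftarrow>bs. \<Sum>K\<leftarrow>Ks. norm2 (dA * d) (factored n d (?f K p)))
        = norm2 (dA * dB) (factored n dB p)"
      using instrument_isometry_sum[OF inst, where J = "{..<dA}" and G = "\<lambda>a b. factored n dB p (a * dB + b)"]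
      by (simp add: norm2_mult_rows)
  qed
  \<comment> \<open>The roles are exchanged: the isometry acts on the rows of Y and the norm of X is
    a constant factor.\<close>
  have fr: "(\<Sum>(d, Ks, P)\<leftarrow>bs. \<Sum>(K, p)\<leftarrow>List.product Ks L. frob dA n (fst (?f K p)) * frob n d (snd (?f K p)))
      = (\<Sum>p\<leftarrow>L. frob dA n (fst p) * frob n dB (snd p))"
  proof (rule sum_branches_product)
    fix p
    show "(\<Sum>(d, Ks, P)\<leftarrow>bs. \<Sum>K\<leftarrow>Ks. frob dA n (fst (?f K p)) * frob n d (snd (?f K p)))
        = frob dA n (fst p) * frob n dB (snd p)"
      using instrument_isometry_sum[OF inst, where J = "{..<n}" and G = "\<lambda>k b. snd p k b"]
      by (simp add: frob_rows[of n] case_prod_unfold sum_list_const_mult)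
  qed
  have "2 * (\<Sum>(d, Ks, P)\<leftarrow>bs. \<Sum>(K, p)\<leftarrow>List.product Ks L. norm2 (dA * d) (factored n d (?f K p)))
     = (\<Sum>(d, Ks, P)\<leftarrow>bs. 2 * (\<Sum>(K, p)\<leftarrow>List.product Ks L. norm2 (dA * d) (factored n d (?f K p))))"
    by (simp add: case_prod_unfold sum_list_const_mult)
  also have "\<dots> \<le> (\<Sum>(d, Ks, P)\<leftarrow>bs. \<Sum>(K, p)\<leftarrow>List.product Ks L. frob dA n (fst (?f K p)) * frob n d (snd (?f K p)))"
    using branch by (intro sum_list_mono) (auto simp del: fst_conv snd_conv)
  finally show ?case
    unfolding tr fr .
qed

section \<open>The transfer protocol\<close>

lemma tensor_amp:
  assumes "dim_vec u = 4" "dim_vec v = 8" "a < 2" "b < 2" "a' < 2" "b' < 2" "k < 2"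
  shows "amp (tensor_vec u v) a b a' b' k = u $ (2 * a + b) * v $ (4 * a' + 2 * b' + k)"
proof -
  define p q where "p = 2 * a + b" and "q = 4 * a' + 2 * b' + k"
  have index: "16 * a + 8 * b + 4 * a' + 2 * b' + k = p * 8 + q" and "p < 4" "q < 8"
    using assms by (auto simp: p_def q_def)
  moreover from \<open>p < 4\<close> \<open>q < 8\<close> have "p * 8 + q < 4 * 8"
    by (rule nat_index_less)
  ultimately have "amp (tensor_vec u v) a b a' b' k = u $ p * v $ q"
    using assms(1,2) by (simp add: amp_def tensor_vec_def)
  then show ?thesis
    by (simp add: p_def q_def)
qed

lemma bank_order_index:
  assumes "a < 2" "b < 2" "a' < 2" "b' < 2" "k < 2"
  shows "bank_order \<Psi> $ (16 * a + 8 * a' + 4 * b + 2 * b' + k) = amp \<Psi> a b a' b' k"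
  using assms[THEN less_2_cases] by (elim disjE) (simp_all add: bank_order_def)

lemma transfer_order_index:
  assumes "a < 2" "b < 2" "a' < 2" "b' < 2" "k < 2"
  shows "transfer_order \<Psi> $ (16 * a + 8 * a' + 4 * k + 2 * b + b') = amp \<Psi> a b a' b' k"
  using assms[THEN less_2_cases] by (elim disjE) (simp_all add: transfer_order_def)

lemma dim_link: "dim_vec (link \<theta>) = 4"
  by (simp add: link_def)

lemma dim_W_state: "dim_vec (W_state \<alpha> \<beta> \<gamma>) = 8"
  by (simp add: W_state_def)

lemma link_index: "link \<theta> $ i = [complex_of_real (cos \<theta>), 0, 0, complex_of_real (sin \<theta>)] ! i"
  unfolding link_def vec_of_list_index ..

lemma W_state_index:
  "W_state \<alpha> \<beta> \<gamma> $ i = [0, complex_of_real \<alpha>, complex_of_real \<beta>, 0, complex_of_real \<gamma>, 0, 0, 0] ! i"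
  unfolding W_state_def vec_of_list_index ..

lemma bell_index: "bell $ i = [1 / complex_of_real (sqrt 2), 0, 0, 1 / complex_of_real (sqrt 2)] ! i"
  unfolding bell_def vec_of_list_index ..

lemma instrument_single:
  assumes "\<And>K. K \<in> set Ks \<Longrightarrow> K \<in> carrier_mat d n"
    and "\<And>i j. i < n \<Longrightarrow> j < n \<Longrightarrow>
      (\<Sum>K\<leftarrow>Ks. \<Sum>r<d. cnj (K $$ (r, i)) * K $$ (r, j)) = (if i = j then 1 else 0)"
  shows "instrument n [(d, Ks)]"
proof -
  have *: "(mat_adjoint K * K) $$ (i, j) = (\<Sum>r<d. cnj (K $$ (r, i)) * K $$ (r, j))"
    if "K \<in> set Ks" "i < n" "j < n" for K i j
    using mat_adjoint_carrier[OF assms(1)] assms(1) that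
    by (subst mult_index_sum[of _ n d _ n]) (auto simp: mat_adjoint_index[OF assms(1)])
  have "sum_mats n n (map (\<lambda>K. mat_adjoint K * K) Ks) = 1\<^sub>m n"
  proof (rule eq_matI)
    fix i j
    assume "i < dim_row (1\<^sub>m n)" "j < dim_col (1\<^sub>m n)"
    then have ij: "i < n" "j < n"
      by auto
    then have "(\<Sum>K\<leftarrow>Ks. (mat_adjoint K * K) $$ (i, j)) = (\<Sum>K\<leftarrow>Ks. \<Sum>r<d. cnj (K $$ (r, i)) * K $$ (r, j))"
      using * by (metis (mono_tags, lifting) map_eq_conv)
    then show "sum_mats n n (map (\<lambda>K. mat_adjoint K * K) Ks) $$ (i, j) = 1\<^sub>m n $$ (i, j)"
      using ij assms(2)[OF ij] by (simp add: sum_mats_def comp_def del: index_mult_mat)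
  qed (simp_all add: sum_mats_def)
  then show ?thesis
    using assms(1) by (simp add: instrument_def)
qed

lemma pure_state_mixture: "pure_state v = mixture (dim_vec v) [\<lambda>i. v $ i]"
  by (simp add: pure_state_def mixture_def)

context
  fixes u v :: real
  assumes uv: "u\<^sup>2 + v\<^sup>2 = 1"
begin

text \<open>
  For \<open>s = 0\<close> this maps \<open>u|01\<rangle> + v|10\<rangle>\<close> to \<open>|0\<rangle>\<close> and \<open>|00\<rangle>\<close> to \<open>|1\<rangle>\<close>; the case \<open>s = 1\<close>
  covers the orthogonal complement, which does not occur in the run.
\<close>

definition decode :: "nat \<Rightarrow> nat \<Rightarrow> nat \<Rightarrow> complex" where
  "decode s r q = [[[0, of_real u, of_real v, 0], [1, 0, 0, 0]],
     [[0, of_real v, - of_real u, 0], [0, 0, 0, 1]]] ! s ! r ! q"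

text \<open>The bra \<open><a|\<close> on the old qubit A combined with \<open>decode s\<close> on
  A'K. Since all values of \<open>a\<close> and \<open>s\<close> belong to a single outcome, the old
  A is traced out and no information is broadcast.\<close>

definition kraus_A :: "nat \<Rightarrow> nat \<Rightarrow> complex mat" where
  "kraus_A a s = mat 2 8 (\<lambda>(r, p). if p div 4 = a then decode s r (p mod 4) else 0)"

text \<open>The bra \<open><b|\<close> on the old qubit B: it is traced out, and B' takes its
  place.\<close>

definition kraus_B :: "nat \<Rightarrow> complex mat" where
  "kraus_B b = mat 2 4 (\<lambda>(r, q). if q = 2 * b + r then 1 else 0)"

definition swap_protocol :: protocol where
  "swap_protocol = Alice [(2, [kraus_A 0 0, kraus_A 0 1, kraus_A 1 0, kraus_A 1 1],
     Bob [(2, [kraus_B 0, kraus_B 1], Stop)])]"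

text \<open>The four rows of \<open>decode 0\<close> and \<open>decode 1\<close> together form a
  unitary matrix because \<open>u\<^sup>2 + v\<^sup>2 = 1\<close>.\<close>

lemma decode_complete:
  assumes "q < 4" "q' < 4"
  shows "(\<Sum>r<2. cnj (decode 0 r q) * decode 0 r q') + (\<Sum>r<2. cnj (decode 1 r q) * decode 1 r q')
    = (if q = q' then 1 else 0)"
proof -
  have uv': "complex_of_real u * complex_of_real u + complex_of_real v * complex_of_real v = 1"
    using uv by (metis of_real_1 of_real_add of_real_mult power2_eq_square)
  then have vu: "complex_of_real v * complex_of_real v + complex_of_real u * complex_of_real u = 1"
    by (simp only: add.commute)
  have two: "{..<2::nat} = {0, 1}"
    by auto
  have "q = 0 \<or> q = 1 \<or> q = 2 \<or> q = 3" "q' = 0 \<or> q' = 1 \<or> q' = 2 \<or> q' = 3"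
    using assms by auto
  then show ?thesis
    by (elim disjE) (simp_all add: decode_def two uv' vu)
qed

lemma instrument_kraus_A: "instrument 8 [(2, [kraus_A 0 0, kraus_A 0 1, kraus_A 1 0, kraus_A 1 1])]"
proof (rule instrument_single)
  fix i j :: nat
  assume ij: "i < 8" "j < 8"
  have K: "(\<Sum>r<2. cnj (kraus_A a s $$ (r, i)) * kraus_A a s $$ (r, j))
      = (if i div 4 = a \<and> j div 4 = a then \<Sum>r<2. cnj (decode s r (i mod 4)) * decode s r (j mod 4) else 0)"
    for a s
    using ij by (auto simp: kraus_A_def intro!: sum.neutral)
  \<comment> \<open>The index consists of the old bit A (\<open>i div 4\<close>) and the position in
    A'K (\<open>i mod 4\<close>); \<open>K\<close> vanishes unless the A bits agree, so each block
    reduces to \<open>decode_complete\<close>.\<close>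
  have "i div 4 = 0 \<or> i div 4 = 1" "j div 4 = 0 \<or> j div 4 = 1"
    using ij by auto
  moreover have "i = j \<longleftrightarrow> i div 4 = j div 4 \<and> i mod 4 = j mod 4"
    by (metis div_mult_mod_eq)
  ultimately show "(\<Sum>K\<leftarrow>[kraus_A 0 0, kraus_A 0 1, kraus_A 1 0, kraus_A 1 1].
      \<Sum>r<2. cnj (K $$ (r, i)) * K $$ (r, j)) = (if i = j then 1 else 0)"
    using decode_complete[of "i mod 4" "j mod 4"] by (auto simp: K)
qed (auto simp: kraus_A_def)

lemma instrument_kraus_B: "instrument 4 [(2, [kraus_B 0, kraus_B 1])]"
proof (rule instrument_single)
  fix i j :: nat
  assume "i < 4" "j < 4"
  then have ij: "i = 0 \<or> i = 1 \<or> i = 2 \<or> i = 3" "j = 0 \<or> j = 1 \<or> j = 2 \<or> j = 3"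
    by auto
  have two: "{..<2::nat} = {0, 1}"
    by auto
  show "(\<Sum>K\<leftarrow>[kraus_B 0, kraus_B 1]. \<Sum>r<2. cnj (K $$ (r, i)) * K $$ (r, j)) = (if i = j then 1 else 0)"
    using ij by (elim disjE) (simp_all add: kraus_B_def two)
qed (auto simp: kraus_B_def)

lemma locc_swap_protocol: "locc 8 4 swap_protocol"
  using instrument_kraus_A instrument_kraus_B by (simp add: swap_protocol_def)

lemma kraus_A_apply:
  assumes "r < 2" "a < 2"
  shows "(\<Sum>p<8. kraus_A a s $$ (r, p) * h p) = (\<Sum>q<4. decode s r q * h (4 * a + q))"
proof -
  have "(\<Sum>p<2 * 4. kraus_A a s $$ (r, p) * h p)
      = (\<Sum>x<2. \<Sum>q<4. (if x = a then decode s r q * h (4 * a + q) else 0))"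
    unfolding sum_lessThan_mult using assms
    by (intro sum.cong refl) (auto simp: kraus_A_def mult.commute)
  also have "\<dots> = (\<Sum>x<2. if x = a then (\<Sum>q<4. decode s r q * h (4 * a + q)) else 0)"
    by (intro sum.cong) auto
  finally show ?thesis
    using assms by simp
qed

lemma kraus_B_apply:
  assumes "r < 2" "b < 2"
  shows "(\<Sum>q<4. kraus_B b $$ (r, q) * h q) = h (2 * b + r)"
proof -
  have "(\<Sum>q<4. kraus_B b $$ (r, q) * h q) = (\<Sum>q<4. if q = 2 * b + r then h (2 * b + r) else 0)"
    using assms by (intro sum.cong refl) (auto simp: kraus_B_def)
  then show ?thesis
    using assms by simp
qed

text \<open>The W-class state equals \<open>((u|01> + v|10>)|0> + |00>|1>) / sqrt 2\<close> across
  A'K and B', so \<open>decode 0\<close> turns it into the Bell state. For \<open>s = 1\<close> the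
  two terms cancel as vu - uv and \<open>|11>\<close> has amplitude zero. The link contributes only
  a scalar factor.\<close>

lemma swap_protocol_amplitude:
  fixes \<theta> :: real
  defines "\<Psi> \<equiv> transfer_order (tensor_vec (link \<theta>) (W_state (u / sqrt 2) (1 / sqrt 2) (v / sqrt 2)))"
  assumes "a < 2" "b < 2" "s < 2" "i < 4"
  shows "(\<Sum>q<4. kraus_B b $$ (i mod 2, q)
      * (\<Sum>p<8. kraus_A a s $$ ((i div 2 * 4 + q) div 4, p) * \<Psi> $ (p * 4 + (i div 2 * 4 + q) mod 4)))
    = link \<theta> $ (2 * a + b) * (if s = 0 then bell $ i else 0)"
proof -
  have i: "i mod 2 < 2" "i div 2 < 2"
    using assms by auto
  have uv': "complex_of_real u * complex_of_real u + complex_of_real v * complex_of_real v = 1"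
    using uv by (metis of_real_1 of_real_add of_real_mult power2_eq_square)
  have q4: "{..<4::nat} = {0, 1, 2, 3}"
    by auto
  have \<Psi>: "\<Psi> $ ((4 * a + (2 * a' + k)) * 4 + (2 * b + b'))
      = link \<theta> $ (2 * a + b) * W_state (u / sqrt 2) (1 / sqrt 2) (v / sqrt 2) $ (4 * a' + 2 * b' + k)"
    if "a' < 2" "k < 2" "b' < 2" for a' k b'
  proof -
    have "(4 * a + (2 * a' + k)) * 4 + (2 * b + b') = 16 * a + 8 * a' + 4 * k + 2 * b + b'"
      by simp
    then show ?thesis
      unfolding \<Psi>_def
      by (simp only: transfer_order_index tensor_amp dim_link dim_W_state that assms)
  qed
  have "(\<Sum>q<4. kraus_B b $$ (i mod 2, q)
      * (\<Sum>p<8. kraus_A a s $$ ((i div 2 * 4 + q) div 4, p) * \<Psi> $ (p * 4 + (i div 2 * 4 + q) mod 4)))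
    = (\<Sum>q<4. decode s (i div 2) q * \<Psi> $ ((4 * a + q) * 4 + (2 * b + i mod 2)))"
  proof -
    have "2 * b + i mod 2 < 4"
      using i assms by linarith
    then show ?thesis
      by (subst kraus_B_apply[OF i(1) \<open>b < 2\<close>]) (simp add: kraus_A_apply[OF i(2) \<open>a < 2\<close>])
  qed
  also have "\<dots> = link \<theta> $ (2 * a + b) * (\<Sum>q<4. decode s (i div 2) q
      * W_state (u / sqrt 2) (1 / sqrt 2) (v / sqrt 2) $ (4 * (q div 2) + 2 * (i mod 2) + q mod 2))"
    unfolding sum_distrib_left
  proof (intro sum.cong refl)
    fix q :: nat
    assume "q \<in> {..<4}"
    then have "q div 2 < 2" "q mod 2 < 2" "q = 2 * (q div 2) + q mod 2"
      by auto
    with \<Psi>[of "q div 2" "q mod 2" "i mod 2"] i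
    show "decode s (i div 2) q * \<Psi> $ ((4 * a + q) * 4 + (2 * b + i mod 2))
      = link \<theta> $ (2 * a + b) * (decode s (i div 2) q
        * W_state (u / sqrt 2) (1 / sqrt 2) (v / sqrt 2) $ (4 * (q div 2) + 2 * (i mod 2) + q mod 2))"
      by simp
  qed
  also have "(\<Sum>q<4. decode s (i div 2) q
      * W_state (u / sqrt 2) (1 / sqrt 2) (v / sqrt 2) $ (4 * (q div 2) + 2 * (i mod 2) + q mod 2))
    = (if s = 0 then bell $ i else 0)"
  proof -
    have "i \<in> {0, 1, 2, 3}" "s = 0 \<or> s = 1"
      using assms by auto
    then show ?thesis
      using uv' by (auto simp: q4 decode_def W_state_index bell_index simp flip: add_divide_distrib)
  qed
  finally show ?thesis .
qed

text \<open>The squared amplitude of \<open>|1>\<close> at B' is 1/2 here, which is what makes A'K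
  and B' maximally entangled for every admissible \<open>u\<close> and \<open>v\<close>.\<close>

lemma restorable_transfer_balanced:
  "restorable_transfer (tensor_vec (link \<theta>) (W_state (u / sqrt 2) (1 / sqrt 2) (v / sqrt 2)))"
proof -
  define \<Psi> where "\<Psi> = transfer_order (tensor_vec (link \<theta>) (W_state (u / sqrt 2) (1 / sqrt 2) (v / sqrt 2)))"
  define \<sigma> where "\<sigma> = apply_kraus (2 * 2) (map (tensor_mat (1\<^sub>m 2)) [kraus_B 0, kraus_B 1])
    (apply_kraus (2 * 4) (map (\<lambda>K. tensor_mat K (1\<^sub>m 4)) [kraus_A 0 0, kraus_A 0 1, kraus_A 1 0, kraus_A 1 1])
      (pure_state \<Psi>))"
  define As :: "(nat \<times> nat) list" where "As = [(0, 0), (0, 1), (1, 0), (1, 1)]"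
  have KA: "[kraus_A 0 0, kraus_A 0 1, kraus_A 1 0, kraus_A 1 1] = map (\<lambda>(a, s). kraus_A a s) As"
    by (simp add: As_def)
  have \<Psi>: "pure_state \<Psi> = mixture (8 * 4) [\<lambda>i. \<Psi> $ i]"
    by (simp add: pure_state_mixture \<Psi>_def transfer_order_def)
  have "\<sigma> = mixture (2 * 2) (map (\<lambda>(b, a, s) i. \<Sum>q<4. kraus_B b $$ (i mod 2, q)
      * (\<Sum>p<8. kraus_A a s $$ ((i div 2 * 4 + q) div 4, p) * \<Psi> $ (p * 4 + (i div 2 * 4 + q) mod 4)))
      (List.product [0, 1] As))"
    unfolding \<sigma>_def \<Psi> KA
    by (subst apply_kraus_Alice, force simp: kraus_A_def, subst apply_kraus_Bob, force simp: kraus_B_def)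
      (simp add: As_def)
  also have "\<dots> = mixture (2 * 2) (map (\<lambda>(b, a, s) i. link \<theta> $ (2 * a + b) * (if s = 0 then bell $ i else 0))
      (List.product [0, 1] As))"
  proof (rule mixture_cong)
    fix l :: "nat \<times> nat \<times> nat" and i :: nat
    assume "l \<in> set (List.product [0, 1] As)" "i < 2 * 2"
    then obtain b a s where "l = (b, a, s)" "a < 2" "b < 2" "s < 2" "i < 4"
      by (auto simp: As_def)
    then show "(case l of (b, a, s) \<Rightarrow> \<lambda>i. \<Sum>q<4. kraus_B b $$ (i mod 2, q)
        * (\<Sum>p<8. kraus_A a s $$ ((i div 2 * 4 + q) div 4, p) * \<Psi> $ (p * 4 + (i div 2 * 4 + q) mod 4))) i
      = (case l of (b, a, s) \<Rightarrow> \<lambda>i. link \<theta> $ (2 * a + b) * (if s = 0 then bell $ i else 0)) i"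
      unfolding \<Psi>_def by (simp only: prod.case swap_protocol_amplitude)
  qed
  \<comment> \<open>Only \<open>s = 0\<close> with \<open>a = b\<close> survives, leaving the Bell
    vector scaled by cos \<theta> and by sin \<theta>; the two squares add up to 1.\<close>
  also have "\<dots> = pure_state bell"
  proof -
    have dim: "dim_vec bell = 4"
      by (simp add: bell_def)
    have "(complex_of_real (cos \<theta>))\<^sup>2 + (complex_of_real (sin \<theta>))\<^sup>2 = 1"
      by (metis of_real_1 of_real_add of_real_power sin_cos_squared_add2)
    moreover have "complex_of_real (cos \<theta>) * x * (complex_of_real (cos \<theta>) * y)
        + complex_of_real (sin \<theta>) * x * (complex_of_real (sin \<theta>) * y)
        = ((complex_of_real (cos \<theta>))\<^sup>2 + (complex_of_real (sin \<theta>))\<^sup>2) * (x * y)" for x y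
      by (simp only: power2_eq_square distrib_left distrib_right mult_ac)
    ultimately have "complex_of_real (cos \<theta>) * x * (complex_of_real (cos \<theta>) * y)
        + complex_of_real (sin \<theta>) * x * (complex_of_real (sin \<theta>) * y) = x * y" for x y
      by simp
    then show ?thesis
      unfolding pure_state_def mixture_def dim
      by (intro cong_mat) (simp_all add: As_def link_index del: sin_of_real cos_of_real)
  qed
  finally have \<sigma>: "\<sigma> = pure_state bell" .
  have four: "{..<4::nat} = {0, 1, 2, 3}"
    by auto
  have tr: "mat_trace \<sigma> = 1"
    by (simp add: \<sigma> mat_trace_def pure_state_def bell_def[THEN arg_cong[where f = dim_vec]] four bell_index
        flip: of_real_mult)
  have "reduced_AB 1 1 \<sigma> = \<sigma>"
    by (rule eq_matI) (auto simp: \<sigma> reduced_AB_def pure_state_def bell_def[THEN arg_cong[where f = dim_vec]] mult.commute)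
  moreover have "branches 8 4 swap_protocol (pure_state \<Psi>) = [(2, 2, \<sigma>)]"
    by (simp add: swap_protocol_def \<sigma>_def)
  ultimately have "restores 8 4 swap_protocol (pure_state \<Psi>)"
    using tr \<sigma> by (auto simp: restores_def intro!: exI[of _ 1])
  then show ?thesis
    using locc_swap_protocol by (auto simp: restorable_transfer_def \<Psi>_def)
qed

end

section \<open>Measurements of the Bank\<close>

text \<open>Any amplitude matrix M is the product of diag(sqrt w) and diag(1 / sqrt w) * M.\<close>

lemma factored_diagonal:
  assumes "\<And>x. x < m \<Longrightarrow> w x > 0" "i < m * l"
  shows "factored m l (\<lambda>x k. if x = k then complex_of_real (sqrt (w x)) else 0,
      \<lambda>k y. f (k * l + y) / complex_of_real (sqrt (w k))) i = f i"
proof -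
  have "i div l < m"
    using assms(2) by (simp add: less_mult_imp_div_less)
  moreover from this have "sqrt (w (i div l)) \<noteq> 0"
    using assms(1) by (metis less_irrefl real_sqrt_eq_zero_cancel_iff)
  moreover from this have "factored m l (\<lambda>x k. if x = k then complex_of_real (sqrt (w x)) else 0,
      \<lambda>k y. f (k * l + y) / complex_of_real (sqrt (w k))) i = (\<Sum>k<m. if k = i div l then f i else 0)"
    unfolding factored_def by (intro sum.cong refl) auto
  ultimately show ?thesis
    by simp
qed

text \<open>The diagonal factorisation inserted into \<open>restores_bound\<close>. The same X
  serves all ensemble vectors, so the right side depends on the state only through the diagonal of
  Alice's marginal, and linearly. This linearity later allows summing over the outcomes of the
  Bank.\<close>

lemma restores_marginal_bound:
  assumes "locc dA dB P" "restores dA dB P (mixture (dA * dB) fs)"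
    and w: "\<And>x. x < dA \<Longrightarrow> w x > 0"
  shows "2 * (\<Sum>f\<leftarrow>fs. norm2 (dA * dB) f)
    \<le> (\<Sum>x<dA. w x) * (\<Sum>x<dA. (\<Sum>y<dB. \<Sum>f\<leftarrow>fs. (cmod (f (x * dB + y)))\<^sup>2) / w x)"
proof -
  let ?X = "\<lambda>x k. if x = k then complex_of_real (sqrt (w x)) else 0"
  let ?Y = "\<lambda>f k y. f (k * dB + y) / complex_of_real (sqrt (w k))"
  let ?L = "map (\<lambda>f. (?X, ?Y f)) fs"
  have fac: "factored dA dB (?X, ?Y f) i = f i" if "i < dA * dB" for f i
    using w that by (rule factored_diagonal)
  have "mixture (dA * dB) (map (factored dA dB) ?L) = mixture (dA * dB) (map (\<lambda>f. f) fs)"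
    unfolding map_map comp_def by (rule mixture_cong) (rule fac)
  then have "2 * (\<Sum>p\<leftarrow>?L. norm2 (dA * dB) (factored dA dB p))
      \<le> (\<Sum>p\<leftarrow>?L. frob dA dA (fst p) * frob dA dB (snd p))"
    using assms(2) by (intro restores_bound[OF assms(1)]) simp
  moreover have "norm2 (dA * dB) (factored dA dB (?X, ?Y f)) = norm2 (dA * dB) f" for f
    unfolding norm2_def by (intro sum.cong refl) (simp only: fac lessThan_iff)
  moreover have "frob dA dA ?X = (\<Sum>x<dA. w x)"
    unfolding frob_def using w
    by (intro sum.cong refl)
      (simp add: if_distrib[where f = cmod] if_distrib[where f = "\<lambda>x. x\<^sup>2"] less_imp_le cong: if_cong)
  moreover have "frob dA dB (?Y f) = (\<Sum>x<dA. (\<Sum>y<dB. (cmod (f (x * dB + y)))\<^sup>2) / w x)" for f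
    unfolding frob_def using w
    by (intro sum.cong refl)
      (simp add: norm_divide power_divide less_imp_le sum_divide_distrib)
  ultimately have "2 * (\<Sum>f\<leftarrow>fs. norm2 (dA * dB) f)
    \<le> (\<Sum>f\<leftarrow>fs. (\<Sum>x<dA. w x) * (\<Sum>x<dA. (\<Sum>y<dB. (cmod (f (x * dB + y)))\<^sup>2) / w x))"
    by (simp add: comp_def)
  also have "\<dots> = (\<Sum>x<dA. w x) * (\<Sum>x<dA. (\<Sum>y<dB. \<Sum>f\<leftarrow>fs. (cmod (f (x * dB + y)))\<^sup>2) / w x)"
    by (simp add: sum_list_const_mult divide_inverse sum_list_sum_swap sum_list_mult_const)
  finally show ?thesis .
qed

section \<open>Measurement operators of the Bank as ensembles\<close>

lemma psd_2x2_decomposition: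
  fixes a d :: real and b :: complex
  assumes "0 \<le> a" "0 \<le> d" "(cmod b)\<^sup>2 \<le> a * d"
  obtains es where "\<And>M. M \<in> carrier_mat 2 2 \<Longrightarrow> M $$ (0, 0) = of_real a \<Longrightarrow> M $$ (0, 1) = b
    \<Longrightarrow> M $$ (1, 0) = cnj b \<Longrightarrow> M $$ (1, 1) = of_real d \<Longrightarrow> M = mixture 2 es"
proof -
  \<comment> \<open>A Cholesky factorisation with columns (sqrt a, c) and (0, e). For
    \<open>a = 0\<close> the determinant condition forces \<open>b = 0\<close>, so the value 0 is
    right there.\<close>
  define c where "c = (if a = 0 then 0 else cnj b / complex_of_real (sqrt a))"
  define e where "e = sqrt (d - (cmod c)\<^sup>2)"
  define es where "es = [\<lambda>i::nat. if i = 0 then complex_of_real (sqrt a) else c, \<lambda>i. if i = 0 then 0 else complex_of_real e]"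
  have b: "complex_of_real (sqrt a) * cnj c = b"
    using assms by (cases "a = 0") (auto simp: c_def)
  have "(cmod c)\<^sup>2 \<le> d"
    using assms by (cases "a = 0") (auto simp: c_def norm_divide power_divide divide_le_eq mult.commute)
  then have e: "(cmod c)\<^sup>2 + e * e = d"
    by (simp add: e_def)
  have "M = mixture 2 es" if "M \<in> carrier_mat 2 2" "M $$ (0, 0) = of_real a" "M $$ (0, 1) = b"
    "M $$ (1, 0) = cnj b" "M $$ (1, 1) = of_real d" for M
  proof (rule eq_matI)
    fix i j
    assume "i < dim_row (mixture 2 es)" "j < dim_col (mixture 2 es)"
    then have ij: "i < 2" "j < 2"
      by (auto simp: mixture_def)
    have 11: "c * cnj c + complex_of_real e * complex_of_real e = of_real d"
      unfolding e[symmetric] by (simp add: complex_norm_square del: of_real_power)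
    have 10: "c * complex_of_real (sqrt a) = cnj b"
      unfolding b[symmetric] by simp
    have 00: "complex_of_real (sqrt a) * complex_of_real (sqrt a) = of_real a"
      using assms(1) by (simp flip: of_real_mult)
    show "M $$ (i, j) = mixture 2 es $$ (i, j)"
      using less_2_cases[OF ij(1)] less_2_cases[OF ij(2)] that
      by (elim disjE) (simp_all add: mixture_index es_def 00 10 11 b)
  qed (use that in \<open>auto simp: mixture_def\<close>)
  then show ?thesis
    by (rule that)
qed

lemma pos_semidef_2_mixture:
  assumes "pos_semidef 2 E"
  shows "\<exists>es. E = mixture 2 es"
proof -
  have E: "E \<in> carrier_mat 2 2"
    using assms by (simp add: pos_semidef_def)
  have two: "{..<2::nat} = {0, 1}" "{0..<2::nat} = {0, 1}"
    by auto
  have q: "0 \<le> cnj x * (E $$ (0, 0) * x + E $$ (0, 1) * y) + cnj y * (E $$ (1, 0) * x + E $$ (1, 1) * y)" for x y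
  proof -
    define v where "v = vec 2 (\<lambda>i. if i = 0 then x else y)"
    have "0 \<le> (E *\<^sub>v v) \<bullet>c v"
      using assms by (simp add: pos_semidef_def v_def)
    also have "(E *\<^sub>v v) \<bullet>c v = cnj x * (E $$ (0, 0) * x + E $$ (0, 1) * y) + cnj y * (E $$ (1, 0) * x + E $$ (1, 1) * y)"
      using E by (simp add: scalar_prod_def two v_def mult.commute)
    finally show ?thesis .
  qed
  define a where "a = Re (E $$ (0, 0))"
  define d where "d = Re (E $$ (1, 1))"
  define b where "b = E $$ (0, 1)"
  \<comment> \<open>The order on complex numbers compares only numbers with equal imaginary part, so
    positivity also makes the quadratic form real. Hermiticity follows from the test vectors (1, 0),
    (0, 1), (1, 1) and (1, i).\<close>
  have a: "E $$ (0, 0) = of_real a" "0 \<le> a"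
    using q[of 1 0] by (auto simp: a_def less_eq_complex_def complex_eq_iff)
  have d: "E $$ (1, 1) = of_real d" "0 \<le> d"
    using q[of 0 1] by (auto simp: d_def less_eq_complex_def complex_eq_iff)
  have b': "E $$ (1, 0) = cnj b"
  proof -
    have "Im b + Im (E $$ (1, 0)) = 0"
      using q[of 1 1] a d by (auto simp: b_def less_eq_complex_def)
    moreover have "Re b - Re (E $$ (1, 0)) = 0"
      using q[of 1 \<i>] a d by (auto simp: b_def less_eq_complex_def)
    ultimately show ?thesis
      by (simp add: complex_eq_iff)
  qed
  have quad: "0 \<le> a * (cmod x)\<^sup>2 + 2 * Re (cnj x * b * y) + d * (cmod y)\<^sup>2" for x y
  proof -
    have "Re (cnj x * (of_real a * x + b * y) + cnj y * (cnj b * x + of_real d * y))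
        = a * (cmod x)\<^sup>2 + 2 * Re (cnj x * b * y) + d * (cmod y)\<^sup>2"
      unfolding cmod_power2 by (simp add: algebra_simps power2_eq_square)
    moreover have "0 \<le> cnj x * (of_real a * x + b * y) + cnj y * (cnj b * x + of_real d * y)"
      using q[of x y] by (simp only: a(1) d(1) b' b_def)
    ultimately show ?thesis
      by (metis less_eq_complex_def zero_complex.sel(1))
  qed
  have "(cmod b)\<^sup>2 \<le> a * d"
  proof (cases "d = 0")
    case False
    \<comment> \<open>The test vector (d, - cnj b) gives the value d times the determinant.\<close>
    have "2 * Re (cnj (of_real d) * b * (- cnj b)) = - 2 * d * (cmod b)\<^sup>2"
      unfolding cmod_power2 by (simp add: algebra_simps power2_eq_square)
    with quad[of "of_real d" "- cnj b"] have "0 \<le> d * (a * d - (cmod b)\<^sup>2)"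
      using d(2) by (simp add: algebra_simps power2_eq_square)
    then show ?thesis
      using d(2) False by (simp add: zero_le_mult_iff)
  next
    case True
    have "cmod b = 0"
    proof (rule ccontr)
      assume b0: "cmod b \<noteq> 0"
      \<comment> \<open>Chosen so that the form at (1, - t * cnj b) equals a - 2 * (a + 1), which is
        negative.\<close>
      define t where "t = (a + 1) / (cmod b)\<^sup>2"
      have "Re (b * (- of_real t * cnj b)) = - t * (cmod b)\<^sup>2"
        unfolding cmod_power2 by (simp add: algebra_simps power2_eq_square)
      also have "\<dots> = - (a + 1)"
        using b0 by (simp add: t_def)
      finally show False
        using quad[of 1 "- of_real t * cnj b"] a(2) True by simp
    qed
    then show ?thesis
      using True by simp
  qed
  then obtain es where "\<And>M. M \<in> carrier_mat 2 2 \<Longrightarrow> M $$ (0, 0) = of_real a \<Longrightarrow> M $$ (0, 1) = b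
    \<Longrightarrow> M $$ (1, 0) = cnj b \<Longrightarrow> M $$ (1, 1) = of_real d \<Longrightarrow> M = mixture 2 es"
    using psd_2x2_decomposition[OF a(2) d(2)] by blast
  then show ?thesis
    using E a(1) d(1) b' b_def by blast
qed

text \<open>A rank-one term \<open>|e><e|\<close> of the measurement operator leaves the vector
  obtained by contracting K with \<open><e|\<close>. K is the least significant factor, hence the
  index \<open>2 * i + b\<close>.\<close>

lemma post_bank_mixture:
  assumes "dim_vec \<Psi> = 32"
  shows "post_bank (mixture 2 es) (pure_state \<Psi>)
    = mixture 16 (map (\<lambda>e i. \<Sum>b<2. cnj (e b) * \<Psi> $ (2 * i + b)) es)"
proof -
  define E where "E = mixture 2 es"
  have E: "E \<in> carrier_mat 2 2"
    by (simp add: E_def mixture_carrier)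
  have \<Psi>: "pure_state \<Psi> \<in> carrier_mat (16 * 2) (16 * 2)"
    using assms by (simp add: pure_state_def)
  have T: "tensor_mat (1\<^sub>m 16) E \<in> carrier_mat (16 * 2) (16 * 2)"
    using E by (intro tensor_mat_carrier) auto
  have M: "(tensor_mat (1\<^sub>m 16) E * pure_state \<Psi>) $$ (2 * i + k, 2 * j + k)
      = (\<Sum>e\<leftarrow>es. (\<Sum>b<2. cnj (e b) * \<Psi> $ (2 * i + b)) * (e k * cnj (\<Psi> $ (2 * j + k))))"
    if "i < 16" "j < 16" "k < 2" for i j k
  proof -
    have lt: "2 * i + k < 16 * 2" "2 * j + k < 16 * 2"
      using that by auto
    have "(tensor_mat (1\<^sub>m 16) E * pure_state \<Psi>) $$ (2 * i + k, 2 * j + k)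
        = (\<Sum>p<16 * 2. tensor_mat (1\<^sub>m 16) E $$ (2 * i + k, p) * (\<Psi> $ p * cnj (\<Psi> $ (2 * j + k))))"
      unfolding mult_index_sum[OF T \<Psi> lt] using lt assms
      by (intro sum.cong refl) (simp add: pure_state_def)
    also have "\<dots> = (\<Sum>b<2. E $$ (k, b) * (\<Psi> $ (2 * i + b) * cnj (\<Psi> $ (2 * j + k))))"
      unfolding one_tensor_apply[OF E lt(1)] using that by (simp add: mult.commute)
    also have "\<dots> = (\<Sum>b<2. \<Sum>e\<leftarrow>es. cnj (e b) * \<Psi> $ (2 * i + b) * (e k * cnj (\<Psi> $ (2 * j + k))))"
      using that by (intro sum.cong refl) (simp add: E_def mixture_index mult_ac flip: sum_list_const_mult)
    finally show ?thesis
      by (simp add: sum_list_sum_swap sum_distrib_right)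
  qed
  show ?thesis
    unfolding post_bank_def Let_def E_def[symmetric] mixture_def[of 16]
  proof (rule cong_mat, goal_cases)
    case (3 i j)
    then have "(\<Sum>k<2. (tensor_mat (1\<^sub>m 16) E * pure_state \<Psi>) $$ (2 * i + k, 2 * j + k))
        = (\<Sum>k<2. \<Sum>e\<leftarrow>es. (\<Sum>b<2. cnj (e b) * \<Psi> $ (2 * i + b)) * (e k * cnj (\<Psi> $ (2 * j + k))))"
      by (intro sum.cong refl M) auto
    then show ?case
      by (simp add: sum_list_sum_swap[symmetric] sum_distrib_left comp_def del: index_mult_mat)
  qed simp_all
qed

text \<open>The same weights \<open>w\<close> are used for every outcome, so the marginal bounds can
  be added. By completeness of the measurement the marginals of the outcomes add up to the original
  marginal \<open>m\<close>, whatever the Bank measures.\<close>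

lemma restorable_bank_measures_bound:
  assumes "restorable_bank_measures \<Psi>" and w: "\<And>x. x < 4 \<Longrightarrow> w x > 0"
  defines "\<Phi> \<equiv> bank_order \<Psi>"
  defines "m \<equiv> \<lambda>x. \<Sum>y<4. \<Sum>k<2. (cmod (\<Phi> $ (2 * (x * 4 + y) + k)))\<^sup>2"
  shows "2 * (\<Sum>x<4. m x) \<le> (\<Sum>x<4. w x) * (\<Sum>x<4. m x / w x)"
proof -
  obtain Es where Es: "povm 2 Es"
    and P: "\<And>E. E \<in> set Es \<Longrightarrow> \<exists>P. locc 4 4 P \<and> restores 4 4 P (post_bank E (pure_state \<Phi>))"
    using assms(1) by (auto simp: restorable_bank_measures_def \<Phi>_def)
  have "\<exists>es. E = mixture 2 es" if "E \<in> set Es" for E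
    using Es that by (simp add: povm_def pos_semidef_2_mixture)
  then obtain dec where dec: "\<And>E. E \<in> set Es \<Longrightarrow> E = mixture 2 (dec E)"
    by metis
  define g where "g E i = (\<Sum>e\<leftarrow>dec E. (cmod (\<Sum>b<2. cnj (e b) * \<Phi> $ (2 * i + b)))\<^sup>2)" for E i
  have dim: "dim_vec \<Phi> = 32"
    by (simp add: \<Phi>_def bank_order_def)
  have bound: "2 * (\<Sum>x<4. \<Sum>y<4. g E (x * 4 + y)) \<le> (\<Sum>x<4. w x) * (\<Sum>x<4. (\<Sum>y<4. g E (x * 4 + y)) / w x)"
    if "E \<in> set Es" for E
  proof -
    define fs where "fs = map (\<lambda>e i. \<Sum>b<2. cnj (e b) * \<Phi> $ (2 * i + b)) (dec E)"
    obtain P where P: "locc 4 4 P" "restores 4 4 P (post_bank E (pure_state \<Phi>))"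
      using P \<open>E \<in> set Es\<close> by blast
    have "post_bank E (pure_state \<Phi>) = mixture (4 * 4) fs"
      using post_bank_mixture[OF dim, of "dec E"] dec[OF that] by (simp add: fs_def)
    then have "2 * (\<Sum>f\<leftarrow>fs. norm2 (4 * 4) f)
        \<le> (\<Sum>x<4. w x) * (\<Sum>x<4. (\<Sum>y<4. \<Sum>f\<leftarrow>fs. (cmod (f (x * 4 + y)))\<^sup>2) / w x)"
      using P w by (intro restores_marginal_bound) auto
    moreover have "(\<Sum>f\<leftarrow>fs. (cmod (f i))\<^sup>2) = g E i" for i
      by (simp add: fs_def g_def comp_def)
    ultimately show ?thesis
      unfolding norm2_def sum_lessThan_mult by (simp add: sum_list_sum_swap)
  qed
  have one: "(\<Sum>E\<leftarrow>Es. \<Sum>e\<leftarrow>dec E. e i * cnj (e j)) = (if i = j then 1 else 0)" if "i < 2" "j < 2" for i j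
  proof -
    have "sum_mats 2 2 Es $$ (i, j) = 1\<^sub>m 2 $$ (i, j)"
      using Es by (simp add: povm_def)
    then have "(\<Sum>E\<leftarrow>Es. E $$ (i, j)) = (if i = j then 1 else 0)"
      using that by (simp add: sum_mats_def)
    moreover have "E $$ (i, j) = (\<Sum>e\<leftarrow>dec E. e i * cnj (e j))" if "E \<in> set Es" for E
      using mixture_index[OF \<open>i < 2\<close> \<open>j < 2\<close>, of "dec E"] dec[OF that] by simp
    ultimately show ?thesis
      by (metis (mono_tags, lifting) map_eq_conv)
  qed
  have total: "(\<Sum>E\<leftarrow>Es. g E i) = (\<Sum>k<2. (cmod (\<Phi> $ (2 * i + k)))\<^sup>2)" for i
  proof -
    have "complex_of_real ((cmod (\<Sum>b<2. cnj (e b) * \<Phi> $ (2 * i + b)))\<^sup>2)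
        = (\<Sum>b<2. \<Sum>c<2. e c * cnj (e b) * (\<Phi> $ (2 * i + b) * cnj (\<Phi> $ (2 * i + c))))" for e
      unfolding complex_norm_square cnj_sum sum_product by (simp add: mult_ac)
    then have "complex_of_real (\<Sum>E\<leftarrow>Es. g E i)
        = (\<Sum>E\<leftarrow>Es. \<Sum>e\<leftarrow>dec E. \<Sum>b<2. \<Sum>c<2. e c * cnj (e b) * (\<Phi> $ (2 * i + b) * cnj (\<Phi> $ (2 * i + c))))"
      by (simp add: g_def of_real_sum_list del: of_real_power)
    also have "\<dots> = (\<Sum>b<2. \<Sum>c<2. (\<Sum>E\<leftarrow>Es. \<Sum>e\<leftarrow>dec E. e c * cnj (e b)) * (\<Phi> $ (2 * i + b) * cnj (\<Phi> $ (2 * i + c))))"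
      by (simp add: sum_list_sum_swap sum_list_mult_const)
    also have "\<dots> = (\<Sum>b<2. \<Sum>c<2. if c = b then \<Phi> $ (2 * i + b) * cnj (\<Phi> $ (2 * i + b)) else 0)"
      by (intro sum.cong refl) (simp add: one)
    also have "\<dots> = complex_of_real (\<Sum>k<2. (cmod (\<Phi> $ (2 * i + k)))\<^sup>2)"
      by (simp add: complex_norm_square del: of_real_power)
    finally show ?thesis
      by (simp only: of_real_eq_iff)
  qed
  have m: "(\<Sum>E\<leftarrow>Es. \<Sum>y<4. g E (x * 4 + y)) = m x" for x
    by (simp add: m_def sum_list_sum_swap total)
  have "2 * (\<Sum>x<4. m x) = (\<Sum>E\<leftarrow>Es. 2 * (\<Sum>x<4. \<Sum>y<4. g E (x * 4 + y)))"
    by (simp add: sum_list_const_mult sum_list_sum_swap flip: m)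
  also have "\<dots> \<le> (\<Sum>E\<leftarrow>Es. (\<Sum>x<4. w x) * (\<Sum>x<4. (\<Sum>y<4. g E (x * 4 + y)) / w x))"
    using bound by (intro sum_list_mono)
  also have "\<dots> = (\<Sum>x<4. w x) * (\<Sum>x<4. (\<Sum>E\<leftarrow>Es. \<Sum>y<4. g E (x * 4 + y)) / w x)"
    by (simp add: sum_list_const_mult divide_inverse sum_list_mult_const sum_list_sum_swap)
  finally show ?thesis
    by (simp only: m)
qed

section \<open>The explicit parameters\<close>

lemma marginal_link_W:
  assumes "a < 2" "a' < 2"
  shows "(\<Sum>y<4. \<Sum>k<2. (cmod (bank_order (tensor_vec (link \<theta>) (W_state \<alpha> \<beta> \<gamma>))
      $ (2 * ((2 * a + a') * 4 + y) + k)))\<^sup>2)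
    = (if a = 0 then (cos \<theta>)\<^sup>2 else (sin \<theta>)\<^sup>2) * (if a' = 0 then \<alpha>\<^sup>2 + \<beta>\<^sup>2 else \<gamma>\<^sup>2)"
proof -
  let ?\<Phi> = "bank_order (tensor_vec (link \<theta>) (W_state \<alpha> \<beta> \<gamma>))"
  have two: "{..<2::nat} = {0, 1}"
    by auto
  have \<Phi>: "?\<Phi> $ (2 * ((2 * a + a') * 4 + (b * 2 + b')) + k)
      = link \<theta> $ (2 * a + b) * W_state \<alpha> \<beta> \<gamma> $ (4 * a' + 2 * b' + k)"
    if "b < 2" "b' < 2" "k < 2" for b b' k
  proof -
    have "2 * ((2 * a + a') * 4 + (b * 2 + b')) + k = 16 * a + 8 * a' + 4 * b + 2 * b' + k"
      by simp
    then show ?thesis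
      by (simp only: bank_order_index tensor_amp dim_link dim_W_state that assms)
  qed
  have "(\<Sum>y<2 * 2. \<Sum>k<2. (cmod (?\<Phi> $ (2 * ((2 * a + a') * 4 + y) + k)))\<^sup>2)
      = (\<Sum>b<2. \<Sum>b'<2. \<Sum>k<2. (cmod (link \<theta> $ (2 * a + b) * W_state \<alpha> \<beta> \<gamma> $ (4 * a' + 2 * b' + k)))\<^sup>2)"
    unfolding sum_lessThan_mult using \<Phi> by (intro sum.cong refl) auto
  \<comment> \<open>The link contributes only for \<open>b = a\<close>; in the W-class state
    \<open>a' = 0\<close> allows \<alpha> (at \<open>k = 1\<close>) and \<beta> (at
    \<open>b' = 1\<close>), while \<open>a' = 1\<close> allows only \<gamma>.\<close>
  also have "\<dots> = (if a = 0 then (cos \<theta>)\<^sup>2 else (sin \<theta>)\<^sup>2) * (if a' = 0 then \<alpha>\<^sup>2 + \<beta>\<^sup>2 else \<gamma>\<^sup>2)"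
    using assms[THEN less_2_cases]
    by (elim disjE)
      (simp_all add: two link_index W_state_index norm_mult power_mult_distrib algebra_simps
        del: cos_of_real sin_of_real)
  finally show ?thesis
    by simp
qed

theorem corollary6:
  shows "\<exists>\<theta> \<alpha> \<beta> \<gamma> :: real.
    0 < \<theta> \<and> \<theta> \<le> pi / 4 \<and> 0 < \<alpha> \<and> 0 < \<beta> \<and> 0 < \<gamma> \<and> \<alpha>\<^sup>2 + \<beta>\<^sup>2 + \<gamma>\<^sup>2 = 1 \<and>
    restorable_transfer (tensor_vec (link \<theta>) (W_state \<alpha> \<beta> \<gamma>)) \<and>
    \<not> restorable_bank_measures (tensor_vec (link \<theta>) (W_state \<alpha> \<beta> \<gamma>))"
proof -
  \<comment> \<open>The Pythagorean triple 7, 24, 25 makes sine and cosine rational.\<close>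
  define \<theta> where "\<theta> = arcsin (7 / 25)"
  \<comment> \<open>Written as u / sqrt 2, 1 / sqrt 2 and v / sqrt 2 to match
    \<open>restorable_transfer_balanced\<close>, with squares of u and v equal to 98/100 and
    2/100.\<close>
  define \<alpha> \<beta> \<gamma> where "\<alpha> = (7 * sqrt 2 / 10) / sqrt 2" and "\<beta> = 1 / sqrt 2" and "\<gamma> = (sqrt 2 / 10) / sqrt 2"
  have \<alpha>: "\<alpha> = 7 / 10" and \<gamma>: "\<gamma> = 1 / 10" and \<beta>: "\<beta>\<^sup>2 = 1 / 2"
    by (simp_all add: \<alpha>_def \<beta>_def \<gamma>_def power_divide)
  have sin: "(sin \<theta>)\<^sup>2 = 49 / 625"
    by (simp add: \<theta>_def power_divide)
  have cos: "(cos \<theta>)\<^sup>2 = 576 / 625"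
    by (simp add: cos_squared_eq sin)
  have "0 < \<theta>"
    using arcsin_less_arcsin[of 0 "7 / 25"] by (simp add: \<theta>_def)
  moreover have "\<theta> \<le> pi / 4"
  proof -
    have "(7 / 25 :: real) \<le> sqrt 2 / 2"
      using real_sqrt_ge_1_iff[of 2] by linarith
    then have "arcsin (7 / 25) \<le> arcsin (sin (pi / 4))"
      using sqrt2_less_2
      by (intro arcsin_le_arcsin) (auto simp: sin_45)
    then show ?thesis
      by (simp add: \<theta>_def arcsin_sin)
  qed
  moreover have "restorable_transfer (tensor_vec (link \<theta>) (W_state \<alpha> \<beta> \<gamma>))"
    unfolding \<alpha>_def \<beta>_def \<gamma>_def
    by (rule restorable_transfer_balanced) (simp add: power_divide power_mult_distrib)
  moreover have "\<not> restorable_bank_measures (tensor_vec (link \<theta>) (W_state \<alpha> \<beta> \<gamma>))"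
  proof
    assume restorable: "restorable_bank_measures (tensor_vec (link \<theta>) (W_state \<alpha> \<beta> \<gamma>))"
    define m where "m x = (\<Sum>y<4. \<Sum>k<2. (cmod (bank_order (tensor_vec (link \<theta>) (W_state \<alpha> \<beta> \<gamma>))
      $ (2 * (x * 4 + y) + k)))\<^sup>2)" for x
    \<comment> \<open>close to proportional to \<open>sqrt (m x)\<close>, which would be the optimal choice\<close>
    define w :: "nat \<Rightarrow> real" where "w x = [240, 24, 70, 7] ! x" for x
    have four: "{..<4::nat} = {0, 1, 2, 3}"
      by auto
    have "m 0 = 576 / 625 * (99 / 100)" "m 1 = 576 / 625 * (1 / 100)"
      "m 2 = 49 / 625 * (99 / 100)" "m 3 = 49 / 625 * (1 / 100)"
      using marginal_link_W[of 0 0 \<theta> \<alpha> \<beta> \<gamma>] marginal_link_W[of 0 1 \<theta> \<alpha> \<beta> \<gamma>]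
        marginal_link_W[of 1 0 \<theta> \<alpha> \<beta> \<gamma>] marginal_link_W[of 1 1 \<theta> \<alpha> \<beta> \<gamma>]
      by (simp_all add: m_def sin cos \<alpha> \<beta> \<gamma> power_divide)
    moreover have "2 * (\<Sum>x<4. m x) \<le> (\<Sum>x<4. w x) * (\<Sum>x<4. m x / w x)"
    proof -
      have "w x > 0" if "x < 4" for x
      proof -
        have "x = 0 \<or> x = 1 \<or> x = 2 \<or> x = 3"
          using that by auto
        then show ?thesis
          by (elim disjE) (simp_all add: w_def)
      qed
      from restorable_bank_measures_bound[OF restorable this] show ?thesis
        by (simp only: m_def)
    qed
    \<comment> \<open>The marginals sum to 1, so the left side is 2. The weights sum to 341 and the
      quotients to 337.9 / 62500, so the right side is about 1.844.\<close>
    ultimately show False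
      by (simp add: four w_def)
  qed
  moreover have "0 < \<alpha>" "0 < \<beta>" "0 < \<gamma>" "\<alpha>\<^sup>2 + \<beta>\<^sup>2 + \<gamma>\<^sup>2 = 1"
    by (simp_all add: \<alpha> \<beta> \<gamma> power_divide) (simp add: \<beta>_def)
  ultimately show ?thesis
    by blast
qed

end
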